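(* Every right-angled Coxeter group $W_\Gamma$ is profinitely rigid relative to the class of Coxeter groups: if $W$ is any Coxeter group (over a finite labelled graph) with the same set of isomorphism classes of finite quotients as $W_\Gamma$ (equivalently $\widehat W\cong\widehat{W_\Gamma}$), then $W\cong W_\Gamma$.
   Context: For a finite simplicial graph $\Gamma=(V,E)$ with edge labelling $m\colon E\to\mathbb{N}_{\ge2}$, $W_\Gamma=\langle V\mid v^2,\ (vw)^{m(\{v,w\})}\text{ for }\{v,w\}\in E\rangle$; it is right-angled if all labels equal $2$. $\widehat{G}$ is the profinite completion. *)

theory Defs
  imports "HOL-Algebra.Algebra"
begin

definition labelled_graph :: "'a set \<Rightarrow> 'a set set \<Rightarrow> ('a set \<Rightarrow> nat) \<Rightarrow> bool" where
  "labelled_graph V E m \<longleftrightarrow> finite V \<and> (\<forall>e\<in>E. e \<subseteq> V \<and> card e = 2) \<and> (\<forall>e\<in>E. 2 \<le> m e)"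

definition right_angled :: "'a set set \<Rightarrow> ('a set \<Rightarrow> nat) \<Rightarrow> bool" where
  "right_angled E m \<longleftrightarrow> (\<forall>e\<in>E. m e = 2)"

definition coxeter_relators :: "'a set \<Rightarrow> 'a set set \<Rightarrow> ('a set \<Rightarrow> nat) \<Rightarrow> 'a list set" where
  "coxeter_relators V E m =
     {[v, v] | v. v \<in> V} \<union>
     {concat (replicate (m {v, w}) [v, w]) | v w. v \<in> V \<and> w \<in> V \<and> {v, w} \<in> E}"

text \<open>Since all generators are involutions, W_Gamma is the monoid on V modulo the
  congruence generated by r = 1 for every relator r.  Words are lists over V.\<close>
inductive coxeter_eq :: "'a set \<Rightarrow> 'a set set \<Rightarrow> ('a set \<Rightarrow> nat) \<Rightarrow> 'a list \<Rightarrow> 'a list \<Rightarrow> bool"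
  for V E m where
  refl: "set xs \<subseteq> V \<Longrightarrow> coxeter_eq V E m xs xs"
| sym: "coxeter_eq V E m xs ys \<Longrightarrow> coxeter_eq V E m ys xs"
| trans: "coxeter_eq V E m xs ys \<Longrightarrow> coxeter_eq V E m ys zs \<Longrightarrow> coxeter_eq V E m xs zs"
| del: "set xs \<subseteq> V \<Longrightarrow> set ys \<subseteq> V \<Longrightarrow> r \<in> coxeter_relators V E m \<Longrightarrow>
        coxeter_eq V E m (xs @ r @ ys) (xs @ ys)"

definition coxeter_rel :: "'a set \<Rightarrow> 'a set set \<Rightarrow> ('a set \<Rightarrow> nat) \<Rightarrow> ('a list \<times> 'a list) set" where
  "coxeter_rel V E m = {(xs, ys). coxeter_eq V E m xs ys}"

definition coxeter_mult :: "'a set \<Rightarrow> 'a set set \<Rightarrow> ('a set \<Rightarrow> nat) \<Rightarrow> 'a list set \<Rightarrow> 'a list set \<Rightarrow> 'a list set" where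
  "coxeter_mult V E m A B = coxeter_rel V E m `` {(SOME x. x \<in> A) @ (SOME y. y \<in> B)}"

definition coxeter_group :: "'a set \<Rightarrow> 'a set set \<Rightarrow> ('a set \<Rightarrow> nat) \<Rightarrow> ('a list set) monoid" where
  "coxeter_group V E m =
     \<lparr>carrier = {xs. set xs \<subseteq> V} // coxeter_rel V E m,
      Group.monoid.mult = coxeter_mult V E m,
      Group.monoid.one = coxeter_rel V E m `` {[]}\<rparr>"

definition finite_quotient_of :: "('a, 'c) monoid_scheme \<Rightarrow> ('b, 'd) monoid_scheme \<Rightarrow> bool" where
  "finite_quotient_of Q G \<longleftrightarrow> group Q \<and> finite (carrier Q) \<and>
     (\<exists>h. h \<in> hom G Q \<and> h ` carrier G = carrier Q)"

text \<open>G and H have the same isomorphism classes of finite quotients.  Every finite group is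
  isomorphic to one whose carrier is a subset of nat, so it suffices to range over those.\<close>
definition same_finite_quotients :: "('a, 'c) monoid_scheme \<Rightarrow> ('b, 'd) monoid_scheme \<Rightarrow> bool" where
  "same_finite_quotients G H \<longleftrightarrow>
     (\<forall>Q :: nat monoid. finite_quotient_of Q G \<longleftrightarrow> finite_quotient_of Q H)"

end

theory Submission
  imports Defs "HOL-Number_Theory.Number_Theory" "HOL-Computational_Algebra.Computational_Algebra"
begin

text \<open>Write \<open>W\<close> for the right-angled group and \<open>W'\<close> for the other one.

  The kernel of the abelianisation of \<open>W\<close> has a torsion-free profinite completion. Indeed, removing a
  vertex exhibits \<open>W\<close> as an extension of a smaller right-angled group by a free product of involutions,
  and torsion among the even words of such a free product disappears in suitable finite covers. An edge
  of \<open>W'\<close> with label at least 3 is therefore impossible: the commutator of its end points is torsion,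
  but it survives in a finite reflection group over a prime field. So \<open>W'\<close> is right-angled.

  For a right-angled group, the elements of the abelianisation, read as sets of vertices, that lift to
  involutions are exactly the cliques, and this is visible in any finite quotient through which all maps to
  the dihedral group of order 8 factor. Comparing a common finite quotient of this kind yields a linear
  bijection between sets of vertices that preserves cliques. The maximal cliques correspond to the maximal
  subspaces consisting of cliques, so they are preserved as well, and counting vertices by the maximal
  cliques that contain them gives a graph isomorphism.\<close>

section \<open>Words and representations\<close>

text \<open>Equality of finite quotients only says that both groups map onto the same finite groups
  \<open>R\<close>; the surjections for different \<open>R\<close> are unrelated and cannot be
  prescribed. Whatever is read off from \<open>R\<close> must therefore be independent of the
  surjection used. The remedy, for a finite test group \<open>Q\<close>, is a quotient
  \<open>R\<close> of largest size among those whose points are separated by homomorphisms to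
  \<open>Q\<close>. These conditions involve only \<open>R\<close> and the common list of finite
  quotients, so one \<open>R\<close> serves both groups, and every homomorphism from either group to
  \<open>Q\<close> factors through every surjection onto \<open>R\<close>. The test groups are a
  symmetric group containing the image of the reflection representation, and the symmetric group on
  the 8 points of the dihedral action.

  Profinite torsion-freeness is used in finite form: for a finite quotient \<open>G\<close> and an
  exponent \<open>n\<close> there is a finite action such that an even word whose
  \<open>n\<close>-th power acts trivially is already trivial in \<open>G\<close>.

  The reflection representation must be finite, so \<open>2 cos (pi / m)\<close> is replaced by the
  sum of an element of order \<open>2 * m\<close> in a prime field and its inverse; one prime must
  provide these for all labels at once.\<close>

definition eval_word :: "('q, 'z) monoid_scheme \<Rightarrow> ('a \<Rightarrow> 'q) \<Rightarrow> 'a list \<Rightarrow> 'q" where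
  "eval_word Q c xs = foldr (\<lambda>v g. c v \<otimes>\<^bsub>Q\<^esub> g) xs \<one>\<^bsub>Q\<^esub>"

text \<open>A homomorphism from the Coxeter group to \<open>Q\<close>, given by the images of the
  generators. In this form homomorphisms are evaluated on words, and no representative of a class
  has to be chosen.\<close>

definition coxeter_rep :: "'a set \<Rightarrow> 'a set set \<Rightarrow> ('a set \<Rightarrow> nat) \<Rightarrow> ('q, 'z) monoid_scheme \<Rightarrow> ('a \<Rightarrow> 'q) \<Rightarrow> bool" where
  "coxeter_rep V E m Q c \<longleftrightarrow>
     (\<forall>v\<in>V. c v \<in> carrier Q) \<and> (\<forall>r\<in>coxeter_relators V E m. eval_word Q c r = \<one>\<^bsub>Q\<^esub>)"

definition onto_rep :: "'a set \<Rightarrow> 'a set set \<Rightarrow> ('a set \<Rightarrow> nat) \<Rightarrow> ('q, 'z) monoid_scheme \<Rightarrow> ('a \<Rightarrow> 'q) \<Rightarrow> bool" where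
  "onto_rep V E m Q c \<longleftrightarrow> coxeter_rep V E m Q c \<and> eval_word Q c ` {xs. set xs \<subseteq> V} = carrier Q"

lemma eval_word_Nil [simp]: "eval_word Q c [] = \<one>\<^bsub>Q\<^esub>"
  and eval_word_Cons [simp]: "eval_word Q c (v # xs) = c v \<otimes>\<^bsub>Q\<^esub> eval_word Q c xs"
  by (simp_all add: eval_word_def)

lemma coxeter_repD:
  assumes "coxeter_rep V E m Q c"
  shows "v \<in> V \<Longrightarrow> c v \<in> carrier Q" and "r \<in> coxeter_relators V E m \<Longrightarrow> eval_word Q c r = \<one>\<^bsub>Q\<^esub>"
  using assms by (auto simp: coxeter_rep_def)

lemma (in group) eval_word_closed [intro]: "\<forall>v\<in>V. c v \<in> carrier G \<Longrightarrow> set xs \<subseteq> V \<Longrightarrow> eval_word G c xs \<in> carrier G"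
  by (induction xs) auto

lemma (in group) eval_word_append:
  "\<forall>v\<in>V. c v \<in> carrier G \<Longrightarrow> set xs \<subseteq> V \<Longrightarrow> set ys \<subseteq> V \<Longrightarrow> eval_word G c (xs @ ys) = eval_word G c xs \<otimes> eval_word G c ys"
  by (induction xs) (auto simp: m_assoc eval_word_closed)

lemma set_concat_replicate: "set (concat (replicate n xs)) \<subseteq> set xs"
  by (induction n) auto

lemma (in group) eval_word_replicate:
  assumes "\<forall>v\<in>V. c v \<in> carrier G" "set xs \<subseteq> V"
  shows "eval_word G c (concat (replicate n xs)) = eval_word G c xs [^] n"
proof (induction n)
  case (Suc n)
  have "set (concat (replicate n xs)) \<subseteq> V"
    using assms set_concat_replicate by fastforce
  then have "eval_word G c (concat (replicate (Suc n) xs)) = eval_word G c xs \<otimes> eval_word G c xs [^] n"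
    using Suc assms by (simp add: eval_word_append[of V])
  then show ?case
    using assms by (metis eval_word_closed nat_pow_Suc2)
qed auto

lemma eval_word_hom:
  assumes "group G" "group H" "k \<in> hom G H" "\<forall>v\<in>V. c v \<in> carrier G" "set xs \<subseteq> V"
  shows "eval_word H (\<lambda>v. k (c v)) xs = k (eval_word G c xs)"
  using assms(5)
proof (induction xs)
  case Nil
  then show ?case using assms group_hom.hom_one[of G H k] by (simp add: group_hom_def group_hom_axioms_def)
next
  case (Cons v xs)
  then show ?case using assms by (simp add: hom_mult[OF assms(3)] group.eval_word_closed)
qed

lemma eval_word_cong: "(\<And>v. v \<in> set xs \<Longrightarrow> c v = d v) \<Longrightarrow> eval_word Q c xs = eval_word Q d xs"
  by (induction xs) auto

lemma coxeter_relators_subset: "r \<in> coxeter_relators V E m \<Longrightarrow> set r \<subseteq> V"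
  unfolding coxeter_relators_def
  by (auto simp del: set_concat dest!: subsetD[OF set_concat_replicate])

lemma coxeter_rep_hom:
  assumes "group G" "group H" "k \<in> hom G H" "coxeter_rep V E m G c"
  shows "coxeter_rep V E m H (\<lambda>v. k (c v))"
proof -
  have c: "\<forall>v\<in>V. c v \<in> carrier G" using assms(4) by (simp add: coxeter_rep_def)
  have "k \<one>\<^bsub>G\<^esub> = \<one>\<^bsub>H\<^esub>"
    using assms group_hom.hom_one[of G H k] by (simp add: group_hom_def group_hom_axioms_def)
  then show ?thesis
    using assms(4) hom_in_carrier[OF assms(3)]
    by (auto simp: coxeter_rep_def eval_word_hom[OF assms(1-3) c coxeter_relators_subset])
qed

lemma (in group) rep_involution:
  assumes "coxeter_rep V E m G c" "v \<in> V"
  shows "c v \<otimes> c v = \<one>"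
proof -
  have "[v, v] \<in> coxeter_relators V E m" using assms(2) by (auto simp: coxeter_relators_def)
  then have "eval_word G c [v, v] = \<one>" using coxeter_repD(2)[OF assms(1)] by blast
  moreover have "c v \<in> carrier G" using assms by (simp add: coxeter_rep_def)
  ultimately show ?thesis by simp
qed

text \<open>Generators are involutions, so reversing a word inverts it. This is why words without
  inverse letters already produce subgroups.\<close>

lemma (in group) eval_word_rev:
  assumes "coxeter_rep V E m G c" "set xs \<subseteq> V"
  shows "eval_word G c xs \<otimes> eval_word G c (rev xs) = \<one>"
  using assms(2)
proof (induction xs)
  case (Cons v xs)
  have c: "\<forall>v\<in>V. c v \<in> carrier G" using assms(1) by (simp add: coxeter_rep_def)
  have [simp]: "c v \<in> carrier G" "eval_word G c xs \<in> carrier G" "eval_word G c (rev xs) \<in> carrier G"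
    using Cons c by (auto intro!: eval_word_closed[of V])
  have "eval_word G c (v # xs) \<otimes> eval_word G c (rev (v # xs)) = c v \<otimes> (eval_word G c xs \<otimes> eval_word G c (rev xs)) \<otimes> c v"
    using Cons.prems c by (simp add: eval_word_append[of V] m_assoc)
  also have "eval_word G c xs \<otimes> eval_word G c (rev xs) = \<one>" using Cons by simp
  finally show ?case using Cons.prems rep_involution[OF assms(1), of v] by simp
qed simp

section \<open>The group of classes of words\<close>

lemma coxeter_eq_subset: "coxeter_eq V E m xs ys \<Longrightarrow> set xs \<subseteq> V \<and> set ys \<subseteq> V"
  by (induction rule: coxeter_eq.induct) (auto dest: coxeter_relators_subset)

lemma coxeter_eq_eval_word:
  assumes "group Q" "coxeter_rep V E m Q c"
  shows "coxeter_eq V E m xs ys \<Longrightarrow> eval_word Q c xs = eval_word Q c ys"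
proof (induction rule: coxeter_eq.induct)
  case (del xs ys r)
  interpret group Q by fact
  have c: "\<forall>v\<in>V. c v \<in> carrier Q" using assms(2) by (simp add: coxeter_rep_def)
  show ?case using del c assms(2) coxeter_relators_subset[OF del(3)]
    by (simp add: eval_word_append[of V] coxeter_rep_def eval_word_closed[of V])
qed auto

lemma coxeter_eq_append:
  assumes "coxeter_eq V E m xs ys" "set us \<subseteq> V" "set vs \<subseteq> V"
  shows "coxeter_eq V E m (us @ xs @ vs) (us @ ys @ vs)"
  using assms
proof (induction rule: coxeter_eq.induct)
  case (del xs ys r)
  have "coxeter_eq V E m ((us @ xs) @ r @ (ys @ vs)) ((us @ xs) @ (ys @ vs))"
    using del by (intro coxeter_eq.del) auto
  then show ?case by simp
next
  case (refl xs)
  then show ?case by (intro coxeter_eq.refl) auto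
next
  case (sym xs ys)
  then show ?case by (blast intro: coxeter_eq.sym)
next
  case (trans xs ys zs)
  show ?case by (rule coxeter_eq.trans[OF trans.IH(1) trans.IH(2)]) (use trans.prems in auto)
qed

lemma coxeter_eq_append2:
  assumes "coxeter_eq V E m xs xs'" "coxeter_eq V E m ys ys'"
  shows "coxeter_eq V E m (xs @ ys) (xs' @ ys')"
proof (rule coxeter_eq.trans)
  show "coxeter_eq V E m (xs @ ys) (xs' @ ys)"
    using coxeter_eq_append[OF assms(1), of "[]" ys] coxeter_eq_subset[OF assms(2)] by simp
  show "coxeter_eq V E m (xs' @ ys) (xs' @ ys')"
    using coxeter_eq_append[OF assms(2), of xs' "[]"] coxeter_eq_subset[OF assms(1)] by simp
qed

lemma equiv_coxeter_rel: "equiv {xs. set xs \<subseteq> V} (coxeter_rel V E m)"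
  unfolding coxeter_rel_def
proof (rule equivI)
  show "{(xs, ys). coxeter_eq V E m xs ys} \<subseteq> {xs. set xs \<subseteq> V} \<times> {xs. set xs \<subseteq> V}"
    using coxeter_eq_subset by blast
  show "refl_on {xs. set xs \<subseteq> V} {(xs, ys). coxeter_eq V E m xs ys}"
    by (simp add: refl_on_def coxeter_eq.refl)
  show "sym {(xs, ys). coxeter_eq V E m xs ys}"
    unfolding sym_def using coxeter_eq.sym by blast
  show "trans {(xs, ys). coxeter_eq V E m xs ys}"
    unfolding trans_def using coxeter_eq.trans by blast
qed

definition coxeter_class :: "'a set \<Rightarrow> 'a set set \<Rightarrow> ('a set \<Rightarrow> nat) \<Rightarrow> 'a list \<Rightarrow> 'a list set" where
  "coxeter_class V E m xs = {ys. coxeter_eq V E m xs ys}"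

lemma coxeter_rel_Image: "coxeter_rel V E m `` {xs} = coxeter_class V E m xs"
  by (auto simp: coxeter_rel_def coxeter_class_def)

lemma coxeter_class_eq_iff:
  "set xs \<subseteq> V \<Longrightarrow> set ys \<subseteq> V \<Longrightarrow> coxeter_class V E m xs = coxeter_class V E m ys \<longleftrightarrow> coxeter_eq V E m xs ys"
  using eq_equiv_class_iff[OF equiv_coxeter_rel, of xs V ys E m]
  by (simp add: coxeter_rel_Image) (simp add: coxeter_rel_def)

lemma coxeter_class_eqI:
  assumes "coxeter_eq V E m xs ys"
  shows "coxeter_class V E m xs = coxeter_class V E m ys"
  using coxeter_class_eq_iff[of xs V ys E m] coxeter_eq_subset[OF assms] assms by simp

lemma carrier_coxeter_group:
  "carrier (coxeter_group V E m) = coxeter_class V E m ` {xs. set xs \<subseteq> V}"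
  by (auto simp: coxeter_group_def quotient_def coxeter_rel_Image)

text \<open>\<open>coxeter_mult\<close> multiplies representatives picked by \<open>SOME\<close>;
  this makes the pick harmless, also for the maps built in \<open>hom_of_onto_rep\<close> and
  \<open>coxeter_group_iso\<close>.\<close>

lemma coxeter_class_some:
  assumes "set xs \<subseteq> V"
  shows "coxeter_eq V E m xs (SOME x. x \<in> coxeter_class V E m xs)"
proof -
  have "xs \<in> coxeter_class V E m xs" using assms by (simp add: coxeter_class_def coxeter_eq.refl)
  then have "(SOME x. x \<in> coxeter_class V E m xs) \<in> coxeter_class V E m xs" by (rule someI[of "\<lambda>x. x \<in> coxeter_class V E m xs"])
  then show ?thesis by (simp add: coxeter_class_def)
qed

lemma mult_coxeter_group:
  assumes "set xs \<subseteq> V" "set ys \<subseteq> V"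
  shows "coxeter_class V E m xs \<otimes>\<^bsub>coxeter_group V E m\<^esub> coxeter_class V E m ys = coxeter_class V E m (xs @ ys)"
proof -
  let ?x = "SOME x. x \<in> coxeter_class V E m xs" and ?y = "SOME y. y \<in> coxeter_class V E m ys"
  have "coxeter_eq V E m (xs @ ys) (?x @ ?y)"
    using assms by (intro coxeter_eq_append2 coxeter_class_some)
  then have "coxeter_class V E m (xs @ ys) = coxeter_class V E m (?x @ ?y)"
    by (rule coxeter_class_eqI)
  then show ?thesis by (simp add: coxeter_group_def coxeter_mult_def coxeter_rel_Image)
qed

section \<open>Finite quotients as families of generators\<close>

lemma onto_rep_of_hom:
  assumes "group Q" and h: "h \<in> hom (coxeter_group V E m) Q" "h ` carrier (coxeter_group V E m) = carrier Q"
  obtains c where "onto_rep V E m Q c"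
proof -
  interpret group Q by fact
  let ?cl = "coxeter_class V E m"
  define c where "c v = h (?cl [v])" for v
  have h_in: "h (?cl xs) \<in> carrier Q" if "set xs \<subseteq> V" for xs
    using that h(1) by (auto simp: hom_def carrier_coxeter_group)
  have h_append: "h (?cl (xs @ ys)) = h (?cl xs) \<otimes>\<^bsub>Q\<^esub> h (?cl ys)" if "set xs \<subseteq> V" "set ys \<subseteq> V" for xs ys
    using that hom_mult[OF h(1), of "?cl xs" "?cl ys"]
    by (simp add: carrier_coxeter_group mult_coxeter_group)
  have h_Nil: "h (?cl []) = \<one>\<^bsub>Q\<^esub>"
    using h_append[of "[]" "[]"] h_in[of "[]"] by simp
  have eval_word: "eval_word Q c xs = h (?cl xs)" if "set xs \<subseteq> V" for xs
    using that
  proof (induction xs)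
    case (Cons v xs)
    then show ?case using h_append[of "[v]" xs] by (simp add: c_def)
  qed (simp add: h_Nil)
  have "eval_word Q c r = \<one>\<^bsub>Q\<^esub>" if r: "r \<in> coxeter_relators V E m" for r
  proof -
    have "coxeter_eq V E m r []" using coxeter_eq.del[of "[]" V "[]" r E m] r by simp
    then have "?cl r = ?cl []" by (rule coxeter_class_eqI)
    then show ?thesis using eval_word[OF coxeter_relators_subset[OF r]] h_Nil by simp
  qed
  moreover have "eval_word Q c ` {xs. set xs \<subseteq> V} = carrier Q"
    unfolding h(2)[symmetric] carrier_coxeter_group image_image by (rule image_cong) (auto simp: eval_word)
  moreover have "\<forall>v\<in>V. c v \<in> carrier Q" using h_in by (simp add: c_def)
  ultimately have "onto_rep V E m Q c" by (simp add: onto_rep_def coxeter_rep_def)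
  then show ?thesis by (rule that)
qed

lemma hom_of_onto_rep:
  assumes "group Q" and c: "onto_rep V E m Q c"
  obtains h where "h \<in> hom (coxeter_group V E m) Q" "h ` carrier (coxeter_group V E m) = carrier Q"
proof -
  interpret group Q by fact
  let ?cl = "coxeter_class V E m"
  define h where "h A = eval_word Q c (SOME x. x \<in> A)" for A
  have c': "\<forall>v\<in>V. c v \<in> carrier Q" and cr: "coxeter_rep V E m Q c"
    using c by (auto simp: onto_rep_def coxeter_rep_def)
  have h: "h (?cl xs) = eval_word Q c xs" if "set xs \<subseteq> V" for xs
    unfolding h_def using coxeter_eq_eval_word[OF assms(1) cr coxeter_class_some[OF that]] by simp
  have "h \<in> hom (coxeter_group V E m) Q"
    by (rule homI) (auto simp: carrier_coxeter_group h mult_coxeter_group eval_word_append[OF c'] intro: eval_word_closed[OF c'])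
  moreover have "h ` carrier (coxeter_group V E m) = carrier Q"
    using c by (simp add: onto_rep_def carrier_coxeter_group image_image h cong: image_cong_simp)
  ultimately show ?thesis by (rule that)
qed

text \<open>Replaces quotients by generating families that satisfy the relators. The classes of
  words return only when the final isomorphism is built.\<close>

lemma finite_quotient_of_coxeter_group:
  "finite_quotient_of Q (coxeter_group V E m) \<longleftrightarrow>
     group Q \<and> finite (carrier Q) \<and> (\<exists>c. onto_rep V E m Q c)"
  unfolding finite_quotient_of_def by (metis onto_rep_of_hom hom_of_onto_rep)

section \<open>Common finite quotients\<close>

text \<open>\<open>same_finite_quotients\<close> speaks of groups on \<open>nat\<close>, whereas
  products and symmetric groups have other carriers. The subgroup of \<open>T\<close> generated by
  the image is therefore transported to numbers; \<open>j\<close> is the inclusion into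
  \<open>T\<close>.\<close>

lemma onto_rep_image:
  fixes T :: "('t, 'z) monoid_scheme" and V :: "'a set"
  assumes "group T" "finite (carrier T)" and c: "coxeter_rep V E m T c"
  obtains R :: "nat monoid" and j d where "group R" "finite (carrier R)" "onto_rep V E m R d"
    "j \<in> hom R T" "inj_on j (carrier R)" "\<And>v. v \<in> V \<Longrightarrow> j (d v) = c v"
proof -
  interpret group T by fact
  have cV: "\<forall>v\<in>V. c v \<in> carrier T" using c by (simp add: coxeter_rep_def)
  define H where "H = eval_word T c ` {xs. set xs \<subseteq> V}"
  have HT: "H \<subseteq> carrier T" using eval_word_closed[OF cV] by (auto simp: H_def)
  have H1: "\<one>\<^bsub>T\<^esub> \<in> H" unfolding H_def by (rule image_eqI[of _ _ "[]"]) auto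
  have Hm: "x \<otimes>\<^bsub>T\<^esub> y \<in> H" if xy: "x \<in> H" "y \<in> H" for x y
  proof -
    obtain xs ys where "set xs \<subseteq> V" "set ys \<subseteq> V" "x = eval_word T c xs" "y = eval_word T c ys"
      using xy unfolding H_def by blast
    then show ?thesis unfolding H_def using eval_word_append[OF cV] by (intro image_eqI[of _ _ "xs @ ys"]) auto
  qed
  have Hi: "\<exists>y\<in>H. y \<otimes>\<^bsub>T\<^esub> x = \<one>\<^bsub>T\<^esub>" if x: "x \<in> H" for x
  proof -
    obtain xs where xs: "set xs \<subseteq> V" "x = eval_word T c xs" using x by (auto simp: H_def)
    then have "eval_word T c (rev xs) \<in> H" unfolding H_def by (intro imageI) auto
    moreover have "eval_word T c (rev xs) \<otimes>\<^bsub>T\<^esub> x = \<one>\<^bsub>T\<^esub>" using eval_word_rev[OF c, of "rev xs"] xs by simp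
    ultimately show ?thesis by blast
  qed
  have "finite H" using HT assms(2) by (rule finite_subset)
  then obtain e :: "'t \<Rightarrow> nat" where "inj_on e H" using finite_imp_inj_to_nat_seg by blast
  define j where "j = inv_into H e"
  have je: "j (e x) = x" if "x \<in> H" for x using that \<open>inj_on e H\<close> by (simp add: j_def)
  define R where "R = \<lparr>carrier = e ` H, Group.monoid.mult = \<lambda>x y. e (j x \<otimes>\<^bsub>T\<^esub> j y), Group.monoid.one = e \<one>\<^bsub>T\<^esub>\<rparr>"
  have R: "carrier R = e ` H" "x \<otimes>\<^bsub>R\<^esub> y = e (j x \<otimes>\<^bsub>T\<^esub> j y)" "\<one>\<^bsub>R\<^esub> = e \<one>\<^bsub>T\<^esub>" for x y
    by (simp_all add: R_def)
  have assoc: "x \<otimes>\<^bsub>T\<^esub> y \<otimes>\<^bsub>T\<^esub> z = x \<otimes>\<^bsub>T\<^esub> (y \<otimes>\<^bsub>T\<^esub> z)" if "x \<in> H" "y \<in> H" "z \<in> H" for x y z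
    using that HT by (intro m_assoc) auto
  have "group R"
  proof (rule groupI)
    fix x assume "x \<in> carrier R"
    then obtain a where a: "a \<in> H" "x = e a" by (auto simp: R)
    show "\<exists>y\<in>carrier R. y \<otimes>\<^bsub>R\<^esub> x = \<one>\<^bsub>R\<^esub>"
    proof -
      obtain y where "y \<in> H" "y \<otimes>\<^bsub>T\<^esub> a = \<one>\<^bsub>T\<^esub>" using Hi[OF a(1)] by blast
      then show ?thesis using a by (intro bexI[of _ "e y"]) (auto simp: R je)
    qed
    show "\<one>\<^bsub>R\<^esub> \<otimes>\<^bsub>R\<^esub> x = x" using a H1 HT by (auto simp: R je subset_iff)
  qed (auto simp: R je Hm H1 assoc)
  moreover have "finite (carrier R)" using \<open>finite H\<close> by (simp add: R)
  moreover have j: "j \<in> hom R T" using HT by (intro homI) (auto simp: R je Hm)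
  moreover have "inj_on j (carrier R)" by (auto simp: inj_on_def R je)
  moreover have cH: "c v \<in> H" if "v \<in> V" for v
    unfolding H_def using that cV by (intro image_eqI[of _ _ "[v]"]) auto
  have eval_word: "eval_word R (\<lambda>v. e (c v)) xs = e (eval_word T c xs)" if "set xs \<subseteq> V" for xs
    using that
  proof (induction xs)
    case (Cons v xs)
    then have "eval_word T c xs \<in> H" by (auto simp: H_def)
    then show ?case using Cons cH by (simp add: R je)
  qed (simp add: R)
  have "onto_rep V E m R (\<lambda>v. e (c v))"
    unfolding onto_rep_def coxeter_rep_def
  proof (intro conjI ballI)
    show "e (c v) \<in> carrier R" if "v \<in> V" for v using that cH by (simp add: R)
    show "eval_word R (\<lambda>v. e (c v)) r = \<one>\<^bsub>R\<^esub>" if "r \<in> coxeter_relators V E m" for r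
      using that c by (simp add: eval_word coxeter_relators_subset coxeter_rep_def R)
    show "eval_word R (\<lambda>v. e (c v)) ` {xs. set xs \<subseteq> V} = carrier R"
      by (auto simp: R eval_word H_def image_image cong: image_cong_simp)
  qed
  moreover have "\<And>v. v \<in> V \<Longrightarrow> j (e (c v)) = c v" by (simp add: je cH)
  ultimately show ?thesis by (rule_tac that) auto
qed

lemma same_finite_quotients_coxeter:
  "same_finite_quotients (coxeter_group V' E' m') (coxeter_group V E m) \<longleftrightarrow>
     (\<forall>R :: nat monoid. group R \<longrightarrow> finite (carrier R) \<longrightarrow>
        (\<exists>c. onto_rep V' E' m' R c) = (\<exists>c. onto_rep V E m R c))"
  by (auto simp: same_finite_quotients_def finite_quotient_of_coxeter_group)

section \<open>Quotients that are universal for a finite target\<close>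

definition separated_by :: "('q, 'z) monoid_scheme \<Rightarrow> ('r, 'y) monoid_scheme \<Rightarrow> bool" where
  "separated_by Q R \<longleftrightarrow>
     (\<forall>x\<in>carrier R. \<forall>y\<in>carrier R. (\<forall>k\<in>hom R Q. k x = k y) \<longrightarrow> x = y)"

text \<open>The kernel of every surjection onto \<open>R\<close> lies in the kernel of every
  homomorphism to \<open>Q\<close>. The quantifier over \<open>c\<close> matters, since the
  surjections supplied by equality of finite quotients are arbitrary.\<close>

definition factors_reps :: "'a set \<Rightarrow> 'a set set \<Rightarrow> ('a set \<Rightarrow> nat) \<Rightarrow> ('q, 'z) monoid_scheme \<Rightarrow> ('r, 'y) monoid_scheme \<Rightarrow> bool" where
  "factors_reps V E m Q R \<longleftrightarrow>
     (\<forall>c d xs ys. onto_rep V E m R c \<longrightarrow> coxeter_rep V E m Q d \<longrightarrow> set xs \<subseteq> V \<longrightarrow> set ys \<subseteq> V \<longrightarrow>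
        eval_word R c xs = eval_word R c ys \<longrightarrow> eval_word Q d xs = eval_word Q d ys)"

lemma factors_repsD:
  "factors_reps V E m Q R \<Longrightarrow> onto_rep V E m R c \<Longrightarrow> coxeter_rep V E m Q d \<Longrightarrow>
    set xs \<subseteq> V \<Longrightarrow> set ys \<subseteq> V \<Longrightarrow> eval_word R c xs = eval_word R c ys \<Longrightarrow> eval_word Q d xs = eval_word Q d ys"
  unfolding factors_reps_def by blast

lemma onto_rep_word:
  assumes "onto_rep V E m R c" "x \<in> carrier R"
  obtains xs where "set xs \<subseteq> V" "eval_word R c xs = x"
  using assms unfolding onto_rep_def by (metis (no_types, lifting) imageE mem_Collect_eq)

text \<open>\<open>separated_by\<close> says that \<open>R\<close> embeds into a power of
  \<open>Q\<close>. A homomorphism to \<open>Q\<close> is determined by the images of the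
  generators, so one factor for each family of elements of \<open>Q\<close> indexed by
  \<open>V\<close> suffices.\<close>

lemma card_separated_quotient_le:
  assumes "group Q" "finite (carrier Q)" "finite V" "group R" "onto_rep V E m R c" "separated_by Q R"
  shows "card (carrier R) \<le> card (PiE (PiE V (\<lambda>_. carrier Q)) (\<lambda>_. carrier Q))"
proof -
  let ?P = "PiE V (\<lambda>_. carrier Q)"
  have cR: "\<forall>v\<in>V. c v \<in> carrier R" and cr: "coxeter_rep V E m R c"
    using assms(5) by (auto simp: onto_rep_def coxeter_rep_def)
  define w where "w x = (SOME xs. set xs \<subseteq> V \<and> eval_word R c xs = x)" for x
  have w: "set (w x) \<subseteq> V" "eval_word R c (w x) = x" if "x \<in> carrier R" for x
  proof -
    have "\<exists>xs. set xs \<subseteq> V \<and> eval_word R c xs = x" using onto_rep_word[OF assms(5) that] by blast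
    then have "set (w x) \<subseteq> V \<and> eval_word R c (w x) = x" unfolding w_def by (rule someI_ex)
    then show "set (w x) \<subseteq> V" "eval_word R c (w x) = x" by auto
  qed
  \<comment> \<open>All families \<open>d\<close> serve as coordinates, also those that violate the
    relators; injectivity uses those of the form \<open>k\<close> after \<open>c\<close>.\<close>
  define F where "F x = (\<lambda>d\<in>?P. eval_word Q d (w x))" for x
  have "F x \<in> PiE ?P (\<lambda>_. carrier Q)" if "x \<in> carrier R" for x
    unfolding F_def by (rule restrict_PiE_iff[THEN iffD2])
      (use w(1)[OF that] in \<open>auto intro!: group.eval_word_closed[OF assms(1), of V]\<close>)
  moreover have "inj_on F (carrier R)"
  proof (rule inj_onI)
    fix x y assume xy: "x \<in> carrier R" "y \<in> carrier R" "F x = F y"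
    have "k x = k y" if k: "k \<in> hom R Q" for k
    proof -
      define d where "d = (\<lambda>v\<in>V. k (c v))"
      have d: "d \<in> ?P" using hom_in_carrier[OF k] cR by (auto simp: d_def)
      have ev_d: "eval_word Q d xs = k (eval_word R c xs)" if "set xs \<subseteq> V" for xs
      proof -
        have "eval_word Q d xs = eval_word Q (\<lambda>v. k (c v)) xs" using that by (intro eval_word_cong) (auto simp: d_def)
        then show ?thesis using eval_word_hom[OF assms(4,1) k cR that] by simp
      qed
      have "F x d = F y d" using xy by simp
      then show ?thesis using d ev_d w xy by (simp add: F_def)
    qed
    then show "x = y" using assms(6) xy by (auto simp: separated_by_def)
  qed
  moreover have "finite (PiE ?P (\<lambda>_. carrier Q))"
    using assms by (intro finite_PiE) auto
  ultimately show ?thesis by (intro card_inj_on_le[of F]) auto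
qed

text \<open>If a representation in \<open>Q\<close> did not factor through \<open>R\<close>, its product with the map onto \<open>R\<close>
  would have a larger image that is still separated by \<open>Q\<close>.\<close>
lemma maximal_separated_factors:
  fixes R :: "nat monoid" and V :: "'a set"
  assumes Q: "group Q" "finite (carrier Q)" and R: "group R" "finite (carrier R)" "separated_by Q R"
    and max: "\<And>R' :: nat monoid. \<And>c. group R' \<Longrightarrow> finite (carrier R') \<Longrightarrow> separated_by Q R' \<Longrightarrow>
       onto_rep V E m R' c \<Longrightarrow> card (carrier R') \<le> card (carrier R)"
  shows "factors_reps V E m Q R"
  unfolding factors_reps_def
proof (intro allI impI)
  fix c d xs ys
  assume c: "onto_rep V E m R c" and d: "coxeter_rep V E m Q d"
    and xs: "set xs \<subseteq> V" and ys: "set ys \<subseteq> V" and eq: "eval_word R c xs = eval_word R c ys"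
  let ?T = "R \<times>\<times> Q"
  have cr: "coxeter_rep V E m R c" using c by (simp add: onto_rep_def)
  have T: "group ?T" "finite (carrier ?T)" using Q R by (auto intro: DirProd_group)
  have ev_T: "eval_word ?T (\<lambda>v. (c v, d v)) zs = (eval_word R c zs, eval_word Q d zs)" for zs
    by (induction zs) auto
  have rep: "coxeter_rep V E m ?T (\<lambda>v. (c v, d v))"
    using cr d by (auto simp: coxeter_rep_def ev_T)
  obtain R' :: "nat monoid" and j b where R': "group R'" "finite (carrier R')" "onto_rep V E m R' b"
    and j: "j \<in> hom R' ?T" "inj_on j (carrier R')" "\<And>v. v \<in> V \<Longrightarrow> j (b v) = (c v, d v)"
    by (rule onto_rep_image[OF T rep], rule that)
  have bR: "\<forall>v\<in>V. b v \<in> carrier R'" using R'(3) by (auto simp: onto_rep_def coxeter_rep_def)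
  have j_ev: "j (eval_word R' b zs) = (eval_word R c zs, eval_word Q d zs)" if "set zs \<subseteq> V" for zs
  proof -
    have "j (eval_word R' b zs) = eval_word ?T (\<lambda>v. j (b v)) zs"
      using eval_word_hom[OF R'(1) T(1) j(1) bR that] by simp
    also have "\<dots> = eval_word ?T (\<lambda>v. (c v, d v)) zs" using that j(3) by (intro eval_word_cong) auto
    finally show ?thesis by (simp add: ev_T)
  qed
  have jf: "(\<lambda>x. fst (j x)) \<in> hom R' R" and js: "(\<lambda>x. snd (j x)) \<in> hom R' Q"
    using j(1) by (auto simp: hom_def Pi_iff mult_DirProd' mem_Times_iff)
  \<comment> \<open>Points of \<open>R'\<close> that differ in the second component are separated by
    the projection to \<open>Q\<close>, the others by a homomorphism from \<open>R\<close> composed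
    with the first projection.\<close>
  have sep: "separated_by Q R'"
    unfolding separated_by_def
  proof (intro ballI impI)
    fix x y assume x: "x \<in> carrier R'" and y: "y \<in> carrier R'" and k: "\<forall>k\<in>hom R' Q. k x = k y"
    have "snd (j x) = snd (j y)" using bspec[OF k js] by simp
    moreover have "k (fst (j x)) = k (fst (j y))" if "k \<in> hom R Q" for k
      using k hom_compose[OF jf that] by (auto simp: comp_def)
    then have "fst (j x) = fst (j y)"
      using R(3) hom_in_carrier[OF jf] x y by (auto simp: separated_by_def)
    ultimately show "x = y" using j(2) x y by (meson inj_onD prod_eqI)
  qed
  have "(\<lambda>x. fst (j x)) ` carrier R' = carrier R"
  proof
    show "carrier R \<subseteq> (\<lambda>x. fst (j x)) ` carrier R'"
    proof
      fix x assume "x \<in> carrier R"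
      then obtain zs where "set zs \<subseteq> V" "eval_word R c zs = x" by (rule onto_rep_word[OF c])
      then show "x \<in> (\<lambda>x. fst (j x)) ` carrier R'"
        using group.eval_word_closed[OF R'(1) bR] by (intro image_eqI[of _ _ "eval_word R' b zs"]) (auto simp: j_ev)
    qed
  qed (use hom_in_carrier[OF jf] in auto)
  \<comment> \<open>By maximality the projection onto \<open>R\<close> cannot identify elements, so
    an equality of words in \<open>R\<close> lifts to \<open>R'\<close> and can be read off in
    \<open>Q\<close>.\<close>
  then have "inj_on (\<lambda>x. fst (j x)) (carrier R')"
    using max[OF R'(1,2) sep R'(3)] card_image_le[OF R'(2), of "\<lambda>x. fst (j x)"] R'(2)
    by (intro eq_card_imp_inj_on) auto
  then have "eval_word R' b xs = eval_word R' b ys"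
    by (rule inj_onD) (use xs ys eq group.eval_word_closed[OF R'(1) bR] in \<open>auto simp: j_ev\<close>)
  then show "eval_word Q d xs = eval_word Q d ys" using j_ev[OF xs] j_ev[OF ys] by simp
qed

text \<open>Up to its last clause the property \<open>good\<close> refers to \<open>R\<close> alone,
  and the last clause holds for one group exactly when it holds for the other. Hence a largest good
  \<open>R\<close> is largest for both.\<close>

lemma common_factoring_quotient:
  fixes V :: "'a set" and V' :: "'b set"
  assumes Q: "group Q" "finite (carrier Q)" and "finite V"
    and same: "same_finite_quotients (coxeter_group V' E' m') (coxeter_group V E m)"
  obtains R :: "nat monoid" and c c' where "group R" "finite (carrier R)"
    "onto_rep V E m R c" "onto_rep V' E' m' R c'" "factors_reps V E m Q R" "factors_reps V' E' m' Q R"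
proof -
  define good where "good R \<longleftrightarrow> group R \<and> finite (carrier R) \<and> separated_by Q R \<and> (\<exists>c. onto_rep V E m R c)"
    for R :: "nat monoid"
  \<comment> \<open>The trivial group, a first good group from which a largest one is
    obtained.\<close>
  define R0 :: "nat monoid" where "R0 = \<lparr>carrier = {0}, Group.monoid.mult = \<lambda>_ _. 0, Group.monoid.one = 0\<rparr>"
  have "group R0" by (rule groupI) (auto simp: R0_def)
  have ev0: "eval_word R0 (\<lambda>_. 0) xs = 0" for xs :: "'a list" by (induction xs) (auto simp: R0_def)
  have "onto_rep V E m R0 (\<lambda>_. 0)"
    by (auto simp: onto_rep_def coxeter_rep_def ev0) (auto simp: R0_def intro!: image_eqI[of _ _ "[]"])
  then have "good R0" using \<open>group R0\<close> by (auto simp: good_def R0_def separated_by_def)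
  moreover have "\<forall>R. good R \<longrightarrow> card (carrier R) < Suc (card (PiE (PiE V (\<lambda>_. carrier Q)) (\<lambda>_. carrier Q)))"
    using card_separated_quotient_le[OF Q \<open>finite V\<close>] by (auto simp: good_def less_Suc_eq_le)
  ultimately obtain R where R: "good R" and max: "\<And>R'. good R' \<Longrightarrow> card (carrier R') \<le> card (carrier R)"
    using ex_has_greatest_nat[of good R0 "\<lambda>R. card (carrier R)"] by blast
  have iff: "(\<exists>c. onto_rep V' E' m' R c) = (\<exists>c. onto_rep V E m R c)"
    if "group R" "finite (carrier R)" for R :: "nat monoid"
    using same that by (simp add: same_finite_quotients_coxeter)
  have "factors_reps V E m Q R"
    by (rule maximal_separated_factors[OF Q]) (use R max in \<open>auto simp: good_def\<close>)
  moreover have "factors_reps V' E' m' Q R"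
    by (rule maximal_separated_factors[OF Q]) (use R max iff in \<open>auto simp: good_def\<close>)
  moreover have "\<exists>c. onto_rep V' E' m' R c" using R iff by (auto simp: good_def)
  ultimately show ?thesis using R that by (auto simp: good_def)
qed

section \<open>Actions on finite sets\<close>

text \<open>A homomorphism to the symmetric group of \<open>Y\<close>, with the behaviour of
  \<open>s v\<close> outside \<open>Y\<close> left open. \<open>coxeter_action_rep\<close> restricts
  the maps, since \<open>BijGroup\<close> consists of extensional functions.\<close>

definition coxeter_action :: "'a set \<Rightarrow> 'a set set \<Rightarrow> ('a set \<Rightarrow> nat) \<Rightarrow> 'y set \<Rightarrow> ('a \<Rightarrow> 'y \<Rightarrow> 'y) \<Rightarrow> bool" where
  "coxeter_action V E m Y s \<longleftrightarrow>
     (\<forall>v\<in>V. \<forall>y\<in>Y. s v y \<in> Y) \<and> (\<forall>r\<in>coxeter_relators V E m. \<forall>y\<in>Y. foldr s r y = y)"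

lemma foldr_closed:
  assumes "\<And>v y. v \<in> V \<Longrightarrow> y \<in> Y \<Longrightarrow> s v y \<in> Y" "set xs \<subseteq> V" "y \<in> Y"
  shows "foldr s xs y \<in> Y"
  using assms(2) by (induction xs) (auto simp: assms)

lemma coxeter_action_rep:
  assumes act: "coxeter_action V E m Y s"
  shows "coxeter_rep V E m (BijGroup Y) (\<lambda>v. restrict (s v) Y)"
    and "set xs \<subseteq> V \<Longrightarrow> eval_word (BijGroup Y) (\<lambda>v. restrict (s v) Y) xs = restrict (foldr s xs) Y"
proof -
  have cl: "s v y \<in> Y" if "v \<in> V" "y \<in> Y" for v y
    using act that by (simp add: coxeter_action_def)
  have inv: "s v (s v y) = y" if "v \<in> V" "y \<in> Y" for v y
  proof -
    have "[v, v] \<in> coxeter_relators V E m" using that by (auto simp: coxeter_relators_def)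
    then have "foldr s [v, v] y = y" using act that unfolding coxeter_action_def by blast
    then show ?thesis by simp
  qed
  have Bij: "restrict (s v) Y \<in> Bij Y" if "v \<in> V" for v
  proof -
    have "bij_betw (s v) Y Y"
      by (rule bij_betwI[of _ _ _ "s v"]) (use cl inv that in auto)
    then show ?thesis by (simp add: Bij_def)
  qed
  have eval_word: "eval_word (BijGroup Y) (\<lambda>v. restrict (s v) Y) xs = restrict (foldr s xs) Y
      \<and> restrict (foldr s xs) Y \<in> Bij Y" if "set xs \<subseteq> V" for xs
    using that
  proof (induction xs)
    case Nil
    have "restrict (foldr s []) Y = (\<lambda>x\<in>Y. x)" by (auto simp: fun_eq_iff)
    then show ?case using id_Bij[of Y] by (simp only: eval_word_Nil) (simp add: BijGroup_def)
  next
    case (Cons v xs)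
    then have v: "v \<in> V" and xs: "set xs \<subseteq> V" by simp_all
    have IH: "eval_word (BijGroup Y) (\<lambda>v. restrict (s v) Y) xs = restrict (foldr s xs) Y"
      and B: "restrict (foldr s xs) Y \<in> Bij Y" using Cons.IH[OF xs] by blast+
    have "compose Y (restrict (s v) Y) (restrict (foldr s xs) Y) = restrict (foldr s (v # xs)) Y"
      using foldr_closed[of V Y s, OF cl xs] by (auto simp: compose_def fun_eq_iff)
    moreover have "restrict (s v) Y \<otimes>\<^bsub>BijGroup Y\<^esub> restrict (foldr s xs) Y =
        compose Y (restrict (s v) Y) (restrict (foldr s xs) Y)"
      unfolding BijGroup_def using Bij[OF v] B by (simp only: monoid.select_convs restrict_apply' refl)
    ultimately show ?case
      using compose_Bij[OF Bij[OF v] B] unfolding eval_word_Cons IH by (simp only: simp_thms)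
  qed
  then show "set xs \<subseteq> V \<Longrightarrow> eval_word (BijGroup Y) (\<lambda>v. restrict (s v) Y) xs = restrict (foldr s xs) Y"
    by blast
  show "coxeter_rep V E m (BijGroup Y) (\<lambda>v. restrict (s v) Y)"
    unfolding coxeter_rep_def
  proof (intro conjI ballI)
    show "restrict (s v) Y \<in> carrier (BijGroup Y)" if "v \<in> V" for v
      using Bij[OF that] by (simp add: BijGroup_def)
    show "eval_word (BijGroup Y) (\<lambda>v. restrict (s v) Y) r = \<one>\<^bsub>BijGroup Y\<^esub>" if "r \<in> coxeter_relators V E m" for r
      using eval_word[OF coxeter_relators_subset[OF that]] act that
      by (auto simp: BijGroup_def coxeter_action_def fun_eq_iff)
  qed
qed

lemma finite_BijGroup: "finite Y \<Longrightarrow> finite (carrier (BijGroup Y))"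
  by (rule finite_subset[of _ "PiE Y (\<lambda>_. Y)"])
    (auto simp: BijGroup_def Bij_def PiE_def bij_betw_def simp del: finite_PiE intro!: finite_PiE[unfolded PiE_def])

lemma restrict_eq_restrict_iff: "restrict f A = restrict g A \<longleftrightarrow> (\<forall>x\<in>A. f x = g x)"
  by (metis restrict_apply' restrict_ext)

definition ra_action :: "'a set \<Rightarrow> 'a set set \<Rightarrow> 'y set \<Rightarrow> ('a \<Rightarrow> 'y \<Rightarrow> 'y) \<Rightarrow> bool" where
  "ra_action V E Y s \<longleftrightarrow> (\<forall>v\<in>V. \<forall>y\<in>Y. s v y \<in> Y \<and> s v (s v y) = y) \<and>
     (\<forall>v\<in>V. \<forall>w\<in>V. {v, w} \<in> E \<longrightarrow> (\<forall>y\<in>Y. s v (s w y) = s w (s v y)))"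

lemma ra_action_coxeter_action:
  assumes "right_angled E m" "ra_action V E Y s"
  shows "coxeter_action V E m Y s"
proof -
  have m: "m e = 2" if "e \<in> E" for e using assms(1) that by (simp add: right_angled_def)
  have s: "s v y \<in> Y" "s v (s v y) = y" if "v \<in> V" "y \<in> Y" for v y
    using assms(2) that by (auto simp: ra_action_def)
  have com: "s v (s w y) = s w (s v y)" if "v \<in> V" "w \<in> V" "{v, w} \<in> E" "y \<in> Y" for v w y
    using assms(2) that unfolding ra_action_def by blast
  have "s v (s w (s v (s w y))) = y" if "v \<in> V" "w \<in> V" "{v, w} \<in> E" "y \<in> Y" for v w y
    using com[OF that] that by (simp add: s)
  then show ?thesis
    by (auto simp: coxeter_action_def coxeter_relators_def m numeral_2_eq_2 s)
qed

text \<open>Numbering the points puts all actions on one type, so that they can be quantified over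
  in an induction on \<open>V\<close> and collected in one disjoint union.\<close>

lemma ra_action_nat:
  fixes Y :: "'y set"
  assumes "ra_action V E Y s" "finite Y"
  shows "\<exists>(N :: nat) s'. ra_action V E {..<N} s' \<and>
    (\<forall>t. set t \<subseteq> V \<longrightarrow> (\<forall>i<N. foldr s' t i = i) \<longrightarrow> (\<forall>y\<in>Y. foldr s t y = y))"
proof -
  obtain h where h: "bij_betw h Y {0..<card Y}" using ex_bij_betw_finite_nat[OF assms(2)] by blast
  define g where "g = inv_into Y h"
  define s' where "s' v i = h (s v (g i))" for v i
  have gh: "g (h y) = y" if "y \<in> Y" for y
    using h that unfolding g_def by (simp add: bij_betw_inv_into_left)
  have hY: "h y < card Y" if "y \<in> Y" for y using bij_betwE[OF h] that by auto
  have g: "g i \<in> Y" "h (g i) = i" if "i < card Y" for i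
    using h that unfolding g_def
    by (auto simp: bij_betw_inv_into_right intro: bij_betwE[OF bij_betw_inv_into[OF h], rule_format])
  have sY: "s v y \<in> Y" "s v (s v y) = y" if "v \<in> V" "y \<in> Y" for v y
    using assms(1) that by (auto simp: ra_action_def)
  have com: "s v (s w y) = s w (s v y)" if "v \<in> V" "w \<in> V" "{v, w} \<in> E" "y \<in> Y" for v w y
    using assms(1) that unfolding ra_action_def by blast
  have fold: "foldr s' t (h y) = h (foldr s t y) \<and> foldr s t y \<in> Y" if "set t \<subseteq> V" "y \<in> Y" for t y
    using that by (induction t) (auto simp: s'_def gh sY)
  show ?thesis
  proof (intro exI conjI allI impI)
    show "ra_action V E {..<card Y} s'"
      unfolding ra_action_def
    proof (intro conjI ballI impI)
      fix v w i assume "v \<in> V" "w \<in> V" "{v, w} \<in> E" "i \<in> {..<card Y}"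
      then show "s' v (s' w i) = s' w (s' v i)" using com[of v w "g i"] by (simp add: s'_def gh sY g)
    qed (auto simp: s'_def gh sY g hY)
    show "\<forall>y\<in>Y. foldr s t y = y" if "set t \<subseteq> V" "\<forall>i<card Y. foldr s' t i = i" for t
    proof
      fix y assume y: "y \<in> Y"
      have "h (foldr s t y) = h y" using fold[OF that(1) y] that(2) hY[OF y] by simp
      then show "foldr s t y = y" using fold[OF that(1) y] gh y by metis
    qed
  qed
qed

text \<open>The disjoint union of finitely many actions, which takes the place of a common
  refinement of finitely many finite quotients.\<close>

lemma ra_action_combine:
  fixes N :: "'i \<Rightarrow> nat"
  assumes "finite I" "\<And>i. i \<in> I \<Longrightarrow> ra_action V E {..<N i} (s i)"
  shows "\<exists>(M :: nat) s'. ra_action V E {..<M} s' \<and>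
    (\<forall>t. set t \<subseteq> V \<longrightarrow> (\<forall>y<M. foldr s' t y = y) \<longrightarrow> (\<forall>i\<in>I. \<forall>y<N i. foldr (s i) t y = y))"
proof -
  define s' where "s' v p = (fst p, s (fst p) v (snd p))" for v and p :: "'i \<times> nat"
  let ?Y = "SIGMA i:I. {..<N i}"
  have s: "s i v y < N i" "s i v (s i v y) = y" if "i \<in> I" "v \<in> V" "y < N i" for i v y
    using assms(2)[OF that(1)] that by (auto simp: ra_action_def)
  have com: "s i v (s i w y) = s i w (s i v y)" if "i \<in> I" "v \<in> V" "w \<in> V" "{v, w} \<in> E" "y < N i" for i v w y
    using assms(2)[OF that(1)] that unfolding ra_action_def by blast
  have "ra_action V E ?Y s'"
    using com by (auto simp: ra_action_def s'_def s)
  moreover have "finite ?Y" using assms(1) by auto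
  ultimately have "\<exists>(N :: nat) s''. ra_action V E {..<N} s'' \<and>
    (\<forall>t. set t \<subseteq> V \<longrightarrow> (\<forall>i<N. foldr s'' t i = i) \<longrightarrow> (\<forall>y\<in>?Y. foldr s' t y = y))"
    by (rule ra_action_nat)
  then obtain M :: nat and s'' where M: "ra_action V E {..<M} s''"
    "\<And>t. set t \<subseteq> V \<Longrightarrow> \<forall>i<M. foldr s'' t i = i \<Longrightarrow> \<forall>y\<in>?Y. foldr s' t y = y"
    by blast
  have fold: "foldr s' t (i, y) = (i, foldr (s i) t y)" for t i y
    by (induction t) (auto simp: s'_def)
  show ?thesis
  proof (intro exI conjI allI impI ballI)
    show "ra_action V E {..<M} s''" by (rule M(1))
    show "foldr (s i) t y = y" if "set t \<subseteq> V" "\<forall>y<M. foldr s'' t y = y" "i \<in> I" "y < N i" for t i y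
    proof -
      have "foldr s' t (i, y) = (i, y)" using M(2)[OF that(1,2)] that(3,4) by blast
      then show "foldr (s i) t y = y" by (simp add: fold)
    qed
  qed
qed

section \<open>Torsion in right-angled groups\<close>

text \<open>Right multiplication by powers of \<open>q\<close> splits the group into cosets;
  \<open>rho\<close> picks a point in each coset, and \<open>sig\<close> is an exponent leading from
  that point to \<open>y\<close>. It is an integer, so it can later be read modulo a multiple of
  \<open>ord q\<close>.\<close>

lemma (in group) coset_section:
  assumes q: "q \<in> carrier G"
  obtains rho sig where
    "\<And>y. y \<in> carrier G \<Longrightarrow> rho y \<in> carrier G"
    "\<And>y. y \<in> carrier G \<Longrightarrow> y = rho y \<otimes> q [^] (sig y :: int)"
    "\<And>y k :: int. y \<in> carrier G \<Longrightarrow> rho (y \<otimes> q [^] k) = rho y"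
proof -
  define C where "C y = range (\<lambda>k :: int. y \<otimes> q [^] k)" for y
  define rho where "rho y = (SOME x. x \<in> C y)" for y
  define sig where "sig y = (SOME k :: int. y = rho y \<otimes> q [^] k)" for y
  have rho_C: "\<exists>k :: int. rho y = y \<otimes> q [^] k" for y
  proof -
    have "y \<otimes> q [^] (0 :: int) \<in> C y" unfolding C_def by (rule rangeI)
    then have "rho y \<in> C y" unfolding rho_def by (rule someI[of "\<lambda>x. x \<in> C y"])
    then show ?thesis by (auto simp: C_def)
  qed
  have 1: "rho y \<in> carrier G" if "y \<in> carrier G" for y
    using rho_C[of y] that q by auto
  have 2: "y = rho y \<otimes> q [^] sig y" if y: "y \<in> carrier G" for y
  proof -
    obtain k :: int where k: "rho y = y \<otimes> q [^] k" using rho_C by blast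
    have "y = rho y \<otimes> q [^] (- k)"
      using y q by (simp add: k m_assoc int_pow_neg)
    then show ?thesis unfolding sig_def by (rule someI)
  qed
  have 3: "rho (y \<otimes> q [^] k) = rho y" if y: "y \<in> carrier G" for y and k :: int
  proof -
    have "C (y \<otimes> q [^] k) = C y"
    proof
      show "C (y \<otimes> q [^] k) \<subseteq> C y"
        using y q by (auto simp: C_def m_assoc int_pow_mult[symmetric])
      show "C y \<subseteq> C (y \<otimes> q [^] k)"
      proof
        fix x assume "x \<in> C y"
        then obtain l :: int where "x = y \<otimes> q [^] l" by (auto simp: C_def)
        then have "x = (y \<otimes> q [^] k) \<otimes> q [^] (l - k)"
          using y q by (simp add: m_assoc int_pow_mult[symmetric])
        then show "x \<in> C (y \<otimes> q [^] k)" by (auto simp: C_def)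
      qed
    qed
    then show ?thesis by (simp add: rho_def)
  qed
  show ?thesis using 1 2 3 by (rule that)
qed

text \<open>Dropping \<open>v\<close> from words is a retraction whose kernel is generated by
  conjugates of \<open>v\<close>. The hypotheses say that, as far as \<open>G\<close> sees it,
  \<open>t\<close> is an even product of such conjugates. If it has value \<open>q\<close>, it adds
  to a counter modulo \<open>ord q * n\<close> an amount \<open>a\<close> with
  \<open>q [^] a = q\<close>; triviality of the \<open>n\<close>-fold word forces
  \<open>ord q\<close> to divide \<open>a\<close>, a contradiction.\<close>

lemma (in group) torsion_step:
  fixes c :: "'v \<Rightarrow> 'a" and n :: nat
  assumes fin: "finite (carrier G)" and v: "v \<in> V"
    and c: "\<And>w. w \<in> V \<Longrightarrow> c w \<in> carrier G" "\<And>w. w \<in> V \<Longrightarrow> c w \<otimes> c w = \<one>"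
    and com: "\<And>u w. u \<in> V \<Longrightarrow> w \<in> V \<Longrightarrow> {u, w} \<in> E \<Longrightarrow> c u \<otimes> c w = c w \<otimes> c u"
    and n: "0 < n" and q: "q \<in> carrier G" "q \<noteq> \<one>"
  shows "\<exists>(N :: nat) s. ra_action V E {..<N} s \<and>
    (\<forall>t. set t \<subseteq> V \<longrightarrow> even (count_list t v) \<longrightarrow> eval_word G c (filter (\<lambda>w. w \<noteq> v) t) = \<one> \<longrightarrow>
       (\<forall>y<N. foldr s (concat (replicate n t)) y = y) \<longrightarrow> eval_word G c t \<noteq> q)"
proof -
  obtain rho sig where rho: "\<And>y. y \<in> carrier G \<Longrightarrow> rho y \<in> carrier G"
    and sig: "\<And>y. y \<in> carrier G \<Longrightarrow> y = rho y \<otimes> q [^] (sig y :: int)"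
    and rho_shift: "\<And>y k :: int. y \<in> carrier G \<Longrightarrow> rho (y \<otimes> q [^] k) = rho y"
    using coset_section[OF q(1)] by blast
  \<comment> \<open>The factor \<open>n\<close> makes \<open>n * a\<close> vanish modulo
    \<open>M\<close> only when \<open>ord q\<close> divides \<open>a\<close>.\<close>
  define M where "M = int (ord q * n)"
  have "0 < ord q" using ord_ge_1[OF fin q(1)] by simp
  then have M: "0 < M" using n by (simp add: M_def)
  have pow_eq: "q [^] (k :: int) = q [^] (l :: int)" if "k mod M = l mod M" for k l
  proof -
    have "M dvd l - k" using that by (metis mod_eq_dvd_iff)
    then have "int (ord q) dvd l - k" unfolding M_def by (metis dvd_mult_left of_nat_mult)
    then show ?thesis using int_pow_eq[OF q(1)] by blast
  qed
  have pow_in [simp]: "q [^] (k :: int) \<in> carrier G" for k using q by simp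
  define R where "R = rho ` carrier G"
  have R: "x \<in> carrier G" "rho x = x" if x: "x \<in> R" for x
  proof -
    obtain y where y: "y \<in> carrier G" "x = rho y" using x by (auto simp: R_def)
    then show "x \<in> carrier G" using rho by simp
    have "rho y = rho (rho y \<otimes> q [^] sig y)" using sig y by simp
    also have "\<dots> = rho (rho y)" using rho_shift rho y by simp
    finally show "rho x = x" using y by simp
  qed
  have rhoR: "rho y \<in> R" if "y \<in> carrier G" for y using that by (simp add: R_def)
  \<comment> \<open>Since \<open>f \<otimes> g f = c v \<otimes> f\<close>, left multiplication of
    \<open>f \<otimes> x\<close> by \<open>c v\<close> can be carried out on \<open>x\<close>,
    leaving \<open>f\<close> in place.\<close>
  define g where "g f = inv f \<otimes> c v \<otimes> f" for f
  have cv: "c v \<in> carrier G" "c v \<otimes> c v = \<one>" using c v by auto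
  have can: "f \<otimes> (inv f \<otimes> x) = x" "inv f \<otimes> (f \<otimes> x) = x" "c v \<otimes> (c v \<otimes> x) = x"
    if "f \<in> carrier G" "x \<in> carrier G" for f x
    using that cv by (simp_all add: m_assoc[symmetric])
  have g: "g f \<in> carrier G" "f \<otimes> g f = c v \<otimes> f" if "f \<in> carrier G" for f
    using that cv by (auto simp: g_def m_assoc can)
  have gg: "g f \<otimes> (g f \<otimes> x) = x" if "f \<in> carrier G" "x \<in> carrier G" for f x
    using that cv by (simp add: g_def m_assoc can)
  have rho_g: "rho (g f \<otimes> rho (g f \<otimes> x)) = x" if "f \<in> carrier G" "x \<in> R" for f x
  proof -
    let ?y = "g f \<otimes> x"
    have y: "?y \<in> carrier G" using that g R by simp
    have "rho (g f \<otimes> rho ?y) = rho (g f \<otimes> rho ?y \<otimes> q [^] sig ?y)"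
      using rho_shift y g that rho by simp
    also have "g f \<otimes> rho ?y \<otimes> q [^] sig ?y = g f \<otimes> ?y"
      using y g that rho sig[OF y] by (simp add: m_assoc)
    also have "\<dots> = x" using gg that R by simp
    finally show ?thesis using R that by simp
  qed
  \<comment> \<open>A pair \<open>(x, k)\<close> stands for \<open>x \<otimes> q [^] k\<close>, but with \<open>k\<close> modulo \<open>ord q * n\<close> instead of \<open>ord q\<close>:
    an element acting as \<open>q\<close> then cannot have order dividing \<open>n\<close>. The lift of \<open>g f\<close> to such pairs need
    not be an involution, so it is used in one direction and its inverse in the other; the Boolean
    records which. The map \<open>Psi\<close> below is equivariant for left translation by \<open>c\<close>.\<close>
  define s where "s w = (\<lambda>(f, e, x, k).
     if w = v then
       if e then (f, False, rho (g f \<otimes> x), (k - sig (g f \<otimes> rho (g f \<otimes> x))) mod M)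
       else (f, True, rho (g f \<otimes> x), (k + sig (g f \<otimes> x)) mod M)
     else (c w \<otimes> f, e, x, k))" for w
  have s_simps: "w \<noteq> v \<Longrightarrow> s w (f, e, x, k) = (c w \<otimes> f, e, x, k)"
    "s v (f, True, x, k) = (f, False, rho (g f \<otimes> x), (k - sig (g f \<otimes> rho (g f \<otimes> x))) mod M)"
    "s v (f, False, x, k) = (f, True, rho (g f \<otimes> x), (k + sig (g f \<otimes> x)) mod M)" for w f e x k
    by (simp_all add: s_def)
  define Y where "Y = carrier G \<times> (UNIV :: bool set) \<times> R \<times> {0..<M}"
  \<comment> \<open>A letter commuting with \<open>v\<close> moves \<open>f\<close> without changing
    the conjugate \<open>g f\<close>; hence the action respects the commutation of \<open>v\<close>
    with its neighbours.\<close>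
  have gc: "g (c w \<otimes> f) = g f" if "w \<in> V" "f \<in> carrier G" "c w \<otimes> c v = c v \<otimes> c w" for w f
  proof -
    have "g (c w \<otimes> f) = inv f \<otimes> (inv (c w) \<otimes> (c v \<otimes> c w)) \<otimes> f"
      using that c cv by (simp add: g_def inv_mult_group m_assoc)
    also have "inv (c w) \<otimes> (c v \<otimes> c w) = c v"
      using that c cv by (simp add: that(3)[symmetric] m_assoc[symmetric])
    finally show ?thesis by (simp add: g_def)
  qed
  have cl: "s w y \<in> Y" if "w \<in> V" "y \<in> Y" for w y
    using that M c by (auto simp: s_def Y_def g R intro!: rhoR)
  have inv: "s w (s w y) = y" if "w \<in> V" "y \<in> Y" for w y
  proof (cases "w = v")
    case True
    then show ?thesis using that M rho_g
      by (auto simp: s_def Y_def mod_simps)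
  next
    case False
    then show ?thesis using that c by (auto simp: s_def Y_def m_assoc[symmetric])
  qed
  have comm: "s u (s w y) = s w (s u y)" if "u \<in> V" "w \<in> V" "{u, w} \<in> E" and Yy: "y \<in> Y" for u w y
  proof -
    obtain f e x k where y: "y = (f, e, x, k)" "f \<in> carrier G" using Yy by (auto simp: Y_def)
    have uw: "c u \<otimes> c w = c w \<otimes> c u" using com that by blast
    have "c u \<otimes> (c w \<otimes> f) = c w \<otimes> (c u \<otimes> f)"
      using that c y uw by (metis m_assoc)
    then show ?thesis using gc[of w f] gc[of u f] that uw y by (auto simp: s_def)
  qed
  have act: "ra_action V E Y s"
    unfolding ra_action_def using cl inv comm by blast
  define Psi where "Psi = (\<lambda>(f, e :: bool, x, k :: int). f \<otimes> x \<otimes> q [^] k)"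
  have pow_mod: "q [^] (k mod M) = q [^] k" for k by (rule pow_eq) simp
  have Psi_s: "Psi (s w y) = c w \<otimes> Psi y" if "w \<in> V" and Yy: "y \<in> Y" for w y
  proof -
    obtain f e x k where y: "y = (f, e, x, k)" "f \<in> carrier G" "x \<in> R" using Yy by (auto simp: Y_def)
    let ?z = "g f \<otimes> x"
    have z: "?z \<in> carrier G" "rho ?z \<in> carrier G" using y g R rho by simp_all
    have fz: "f \<otimes> ?z = c v \<otimes> (f \<otimes> x)" using y g R cv by (metis m_assoc)
    show ?thesis
    proof (cases "w = v")
      case False
      then show ?thesis using y that c R by (simp add: s_def Psi_def m_assoc)
    next
      case w: True
      show ?thesis
      proof (cases e)
        case False
        have "rho ?z \<otimes> (q [^] k \<otimes> q [^] sig ?z) = ?z \<otimes> q [^] k"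
          using sig[OF z(1)] z q by (metis add.commute int_pow_mult m_assoc pow_in)
        then have "Psi (s w y) = f \<otimes> (?z \<otimes> q [^] k)"
          using w y False z q by (simp add: s_def Psi_def pow_mod int_pow_mult m_assoc)
        also have "\<dots> = c v \<otimes> (f \<otimes> x \<otimes> q [^] k)"
          using fz y z R cv by (simp add: m_assoc[symmetric])
        finally show ?thesis using w y by (simp add: Psi_def)
      next
        case True
        let ?u = "g f \<otimes> rho ?z"
        have u: "?u \<in> carrier G" using z y g by simp
        have "?u = x \<otimes> q [^] sig ?u" using sig[OF u] rho_g y by simp
        then have "g f \<otimes> ?u = ?z \<otimes> q [^] sig ?u" using y g R u by (metis m_assoc pow_in)
        then have rz: "rho ?z = ?z \<otimes> q [^] sig ?u" using gg y z by simp
        have "rho ?z \<otimes> q [^] (k - sig ?u) = ?z \<otimes> (q [^] sig ?u \<otimes> q [^] (k - sig ?u))"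
          using z q by (subst rz) (simp add: m_assoc)
        also have "\<dots> = ?z \<otimes> q [^] k" using q by (simp add: int_pow_mult[symmetric])
        finally have "Psi (s w y) = f \<otimes> (?z \<otimes> q [^] k)"
          using w y True z q by (simp add: s_def Psi_def pow_mod m_assoc)
        also have "\<dots> = c v \<otimes> (f \<otimes> x \<otimes> q [^] k)"
          using fz y z R cv by (simp add: m_assoc[symmetric])
        finally show ?thesis using w y by (simp add: Psi_def)
      qed
    qed
  qed
  have Psi_in: "Psi y \<in> carrier G" if "y \<in> Y" for y
    using that R by (auto simp: Psi_def Y_def)
  have cV: "\<forall>w\<in>V. c w \<in> carrier G" using c by blast
  have Psi_fold: "Psi (foldr s t y) = eval_word G c t \<otimes> Psi y" if "set t \<subseteq> V" "y \<in> Y" for t y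
    using that(1)
  proof (induction t)
    case (Cons w t)
    then have "foldr s t y \<in> Y" using foldr_closed[of V Y s, OF cl _ that(2)] by simp
    then show ?case using Cons Psi_s[of w] Psi_in[OF that(2)] c eval_word_closed[OF cV]
      by (simp add: m_assoc)
  qed (use Psi_in that in simp)
  \<comment> \<open>No increment depends on \<open>k\<close>, so a word translates \<open>k\<close>
    by a fixed amount on each fibre. The first coordinate sees only the letters other than
    \<open>v\<close>, and the Boolean only the parity of \<open>v\<close>, so under the hypotheses
    on \<open>t\<close> both return to their start.\<close>
  have shift: "\<exists>x'\<in>R. \<exists>a. \<forall>k. foldr s t (f, e, x, k mod M) =
      (eval_word G c (filter (\<lambda>w. w \<noteq> v) t) \<otimes> f, e \<noteq> odd (count_list t v), x', (k + a) mod M)"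
    if "set t \<subseteq> V" "f \<in> carrier G" "x \<in> R" for t f e x
    using that(1)
  proof (induction t)
    case Nil
    show ?case using that by (intro bexI[of _ x] exI[of _ 0]) auto
  next
    case (Cons w t)
    then obtain x' a where x': "x' \<in> R" and IH: "\<And>k. foldr s t (f, e, x, k mod M) =
      (eval_word G c (filter (\<lambda>w. w \<noteq> v) t) \<otimes> f, e \<noteq> odd (count_list t v), x', (k + a) mod M)" by auto
    have ft: "eval_word G c (filter (\<lambda>w. w \<noteq> v) t) \<in> carrier G" using Cons by (intro eval_word_closed[OF cV]) auto
    show ?case
    proof (cases "w = v")
      case False
      then show ?thesis using Cons.prems c ft that x'
        by (intro bexI[of _ x'] exI[of _ a]) (auto simp: IH s_simps m_assoc)
    next
      case True
      let ?f = "eval_word G c (filter (\<lambda>w. w \<noteq> v) t) \<otimes> f"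
      let ?z = "g ?f \<otimes> x'"
      have "?f \<in> carrier G" using ft that by simp
      then have "rho ?z \<in> R" using g R x' by (intro rhoR) simp
      moreover have "foldr s (w # t) (f, e, x, k mod M) =
          (?f, \<not> (e \<noteq> odd (count_list t v)), rho ?z,
            (k + (if e \<noteq> odd (count_list t v) then a - sig (g ?f \<otimes> rho ?z) else a + sig ?z)) mod M)" for k
      proof (cases "e \<noteq> odd (count_list t v)")
        case e: True
        have "foldr s (w # t) (f, e, x, k mod M) = s v (?f, True, x', (k + a) mod M)"
          using IH[of k] e True by simp
        also have "\<dots> = (?f, False, rho ?z, ((k + a) mod M - sig (g ?f \<otimes> rho ?z)) mod M)"
          by (rule s_simps)
        also have "((k + a) mod M - sig (g ?f \<otimes> rho ?z)) mod M = (k + (a - sig (g ?f \<otimes> rho ?z))) mod M"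
          by (simp add: mod_simps algebra_simps)
        finally show ?thesis using e by simp
      next
        case e: False
        have "foldr s (w # t) (f, e, x, k mod M) = s v (?f, False, x', (k + a) mod M)"
          using IH[of k] e True by simp
        also have "\<dots> = (?f, True, rho ?z, ((k + a) mod M + sig ?z) mod M)"
          by (rule s_simps)
        also have "((k + a) mod M + sig ?z) mod M = (k + (a + sig ?z)) mod M"
          by (simp add: mod_simps algebra_simps)
        finally show ?thesis using e by simp
      qed
      ultimately show ?thesis using True by (intro bexI[of _ "rho ?z"] exI allI) auto
    qed
  qed
  have main: "eval_word G c t \<noteq> q" if t: "set t \<subseteq> V" "even (count_list t v)"
    "eval_word G c (filter (\<lambda>w. w \<noteq> v) t) = \<one>" and triv: "\<forall>y\<in>Y. foldr s (concat (replicate n t)) y = y" for t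
  proof
    assume evq: "eval_word G c t = q"
    define x where "x = rho \<one>"
    have x: "x \<in> R" "x \<in> carrier G" using rhoR R by (auto simp: x_def)
    obtain x' a where x': "x' \<in> R" and st: "\<And>k. foldr s t (\<one>, False, x, k mod M) = (\<one>, False, x', (k + a) mod M)"
      using shift[OF t(1) one_closed x(1), of False] t by auto
    have "(\<one>, False, x, 0) \<in> Y" using x M by (simp add: Y_def)
    from Psi_fold[OF t(1) this] have eq: "x' \<otimes> q [^] a = q \<otimes> x"
      using st[of 0] x x' R M by (simp add: evq Psi_def pow_mod)
    \<comment> \<open>The chosen point \<open>x\<close> of the coset of \<open>\<one>\<close> is a
      power of \<open>q\<close>.\<close>
    have qx: "q \<otimes> x = x \<otimes> q"
    proof -
      have "x = q [^] (- sig \<one>)"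
        using sig[OF one_closed] x q by (metis int_pow_neg inv_equality inv_inv pow_in x_def)
      then show ?thesis using q by (metis int_pow_1 int_pow_mult add.commute)
    qed
    have "rho (x' \<otimes> q [^] a) = rho (x \<otimes> q [^] (1 :: int))" using eq qx q by simp
    then have "x' = x" using rho_shift R x x' by metis
    then have "q [^] a = q" using eq qx x q by simp
    have "foldr s (concat (replicate j t)) (\<one>, False, x, k mod M) = (\<one>, False, x, (k + int j * a) mod M)" for j k
      by (induction j) (simp_all add: st \<open>x' = x\<close> algebra_simps)
    from this[of n 0] have "(int n * a) mod M = 0"
      using triv x M by (auto simp: Y_def)
    then have "int (ord q * n) dvd int n * a" by (simp add: M_def mod_eq_0_iff_dvd)
    then have "int n * int (ord q) dvd int n * a" by (simp add: mult.commute)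
    then have "int (ord q) dvd a" using n by simp
    then have "q [^] (0 :: int) = q [^] a" using int_pow_eq[OF q(1), of 0 a] by simp
    then show False using \<open>q [^] a = q\<close> q by simp
  qed
  have "finite Y" using fin by (simp add: Y_def R_def)
  then obtain N :: nat and s' where N: "ra_action V E {..<N} s'"
    "\<And>t. set t \<subseteq> V \<Longrightarrow> \<forall>i<N. foldr s' t i = i \<Longrightarrow> \<forall>y\<in>Y. foldr s t y = y"
    using ra_action_nat[OF act] by blast
  show ?thesis
  proof (intro exI conjI allI impI)
    show "ra_action V E {..<N} s'" by (rule N(1))
    fix t assume t: "set t \<subseteq> V" "even (count_list t v)" "eval_word G c (filter (\<lambda>w. w \<noteq> v) t) = \<one>"
      and triv: "\<forall>y<N. foldr s' (concat (replicate n t)) y = y"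
    have "set (concat (replicate n t)) \<subseteq> V" by (rule order_trans[OF set_concat_replicate t(1)])
    from N(2)[OF this triv] show "eval_word G c t \<noteq> q" by (rule main[OF t])
  qed
qed

lemma filter_concat_replicate: "filter P (concat (replicate n xs)) = concat (replicate n (filter P xs))"
  by (induction n) auto

text \<open>Even words form the kernel of the abelianisation, and this is the torsion-freeness of
  its profinite completion at the level of one quotient \<open>G\<close> and one exponent
  \<open>n\<close>. In the induction, the action for the smaller vertex set forces the word without
  \<open>v\<close> to be trivial in \<open>G\<close>; each nontrivial value \<open>q\<close> is then
  excluded by its own action from \<open>torsion_step\<close>.\<close>

lemma (in group) torsion_detecting_action:
  fixes c :: "'v \<Rightarrow> 'a" and n :: nat
  assumes fin: "finite (carrier G)" and n: "0 < n" and "finite V"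
    and "\<And>w. w \<in> V \<Longrightarrow> c w \<in> carrier G" "\<And>w. w \<in> V \<Longrightarrow> c w \<otimes> c w = \<one>"
    and "\<And>u w. u \<in> V \<Longrightarrow> w \<in> V \<Longrightarrow> {u, w} \<in> E \<Longrightarrow> c u \<otimes> c w = c w \<otimes> c u"
  shows "\<exists>(N :: nat) s. ra_action V E {..<N} s \<and>
    (\<forall>t. set t \<subseteq> V \<longrightarrow> (\<forall>w\<in>V. even (count_list t w)) \<longrightarrow>
       (\<forall>y<N. foldr s (concat (replicate n t)) y = y) \<longrightarrow> eval_word G c t = \<one>)"
  using assms(3-)
proof (induction V rule: finite_induct)
  case empty
  have "ra_action {} E {..<0 :: nat} (\<lambda>_. id)" by (simp add: ra_action_def)
  then show ?case by (intro exI[of _ 0] exI[of _ "\<lambda>_. id"]) (simp add: ra_action_def)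
next
  case (insert v V)
  have "\<exists>(N :: nat) s. ra_action V E {..<N} s \<and>
    (\<forall>t. set t \<subseteq> V \<longrightarrow> (\<forall>w\<in>V. even (count_list t w)) \<longrightarrow>
       (\<forall>y<N. foldr s (concat (replicate n t)) y = y) \<longrightarrow> eval_word G c t = \<one>)"
    by (rule insert.IH) (use insert.prems in auto)
  then obtain N0 :: nat and s0 where act0: "ra_action V E {..<N0} s0"
    and t0: "\<And>t. set t \<subseteq> V \<Longrightarrow> \<forall>w\<in>V. even (count_list t w) \<Longrightarrow>
       \<forall>y<N0. foldr s0 (concat (replicate n t)) y = y \<Longrightarrow> eval_word G c t = \<one>"
    by blast
  define s1 where "s1 w = (if w = v then id else s0 w)" for w
  have act1: "ra_action (insert v V) E {..<N0} s1"
    using act0 insert.hyps by (auto simp: ra_action_def s1_def)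
  have fold1: "foldr s1 t y = foldr s0 (filter (\<lambda>w. w \<noteq> v) t) y" for t y
    by (induction t) (auto simp: s1_def)
  have "\<exists>N s. ra_action (insert v V) E {..<N :: nat} s \<and>
      (\<forall>t. set t \<subseteq> insert v V \<longrightarrow> even (count_list t v) \<longrightarrow> eval_word G c (filter (\<lambda>w. w \<noteq> v) t) = \<one> \<longrightarrow>
       (\<forall>y<N. foldr s (concat (replicate n t)) y = y) \<longrightarrow> eval_word G c t \<noteq> q)"
    if q: "q \<in> carrier G" "q \<noteq> \<one>" for q
    by (rule torsion_step[OF fin insertI1 _ _ _ n q]) (use insert.prems in auto)
  then obtain N s where act: "\<And>q. q \<in> carrier G \<Longrightarrow> q \<noteq> \<one> \<Longrightarrow> ra_action (insert v V) E {..<N q :: nat} (s q)"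
    and t: "\<And>q t. q \<in> carrier G \<Longrightarrow> q \<noteq> \<one> \<Longrightarrow> set t \<subseteq> insert v V \<Longrightarrow> even (count_list t v) \<Longrightarrow>
       eval_word G c (filter (\<lambda>w. w \<noteq> v) t) = \<one> \<Longrightarrow>
       \<forall>y<N q. foldr (s q) (concat (replicate n t)) y = y \<Longrightarrow> eval_word G c t \<noteq> q"
    by metis
  \<comment> \<open>The index \<open>\<one>\<close>, for which \<open>torsion_step\<close> offers
    nothing, holds the action of the induction hypothesis.\<close>
  define N' where "N' q = (if q = \<one> then N0 else N q)" for q
  define s' where "s' q = (if q = \<one> then s1 else s q)" for q
  have "ra_action (insert v V) E {..<N' q} (s' q)" if "q \<in> carrier G" for q
    using act act1 that by (simp add: N'_def s'_def)
  then obtain M :: nat and s2 where M: "ra_action (insert v V) E {..<M} s2"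
    "\<And>t q. set t \<subseteq> insert v V \<Longrightarrow> \<forall>y<M. foldr s2 t y = y \<Longrightarrow> q \<in> carrier G \<Longrightarrow> \<forall>y<N' q. foldr (s' q) t y = y"
    using ra_action_combine[OF fin, of "insert v V" E N' s'] by blast
  have "eval_word G c t = \<one>"
    if tV: "set t \<subseteq> insert v V" and eval_word: "\<forall>w\<in>insert v V. even (count_list t w)"
      and triv: "\<forall>y<M. foldr s2 (concat (replicate n t)) y = y" for t
  proof (rule ccontr)
    assume ne: "eval_word G c t \<noteq> \<one>"
    have q: "eval_word G c t \<in> carrier G" by (rule eval_word_closed[of "insert v V"]) (use insert.prems tV in auto)
    have tnV: "set (concat (replicate n t)) \<subseteq> insert v V" by (rule order_trans[OF set_concat_replicate tV])
    let ?t = "filter (\<lambda>w. w \<noteq> v) t"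
    have "count_list ?t w = count_list t w" if "w \<noteq> v" for w
      using that by (induction t) auto
    then have "\<forall>w\<in>V. even (count_list ?t w)" using eval_word insert.hyps by (metis insertI2)
    moreover have "\<forall>y<N0. foldr s0 (concat (replicate n ?t)) y = y"
      using M(2)[OF tnV triv one_closed] by (simp add: N'_def s'_def fold1 filter_concat_replicate)
    ultimately have "eval_word G c ?t = \<one>" using tV by (intro t0) auto
    moreover have "\<forall>y<N (eval_word G c t). foldr (s (eval_word G c t)) (concat (replicate n t)) y = y"
      using M(2)[OF tnV triv q] ne by (simp add: N'_def s'_def)
    ultimately show False using t[OF q ne tV] eval_word by simp
  qed
  then show ?case using M(1) by blast
qed

section \<open>Primes with an element of given order\<close>

definition eval_complex :: "complex \<Rightarrow> int poly \<Rightarrow> complex" where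
  "eval_complex z p = poly (map_poly of_int p) z"

lemma eval_complex_pCons: "eval_complex z (pCons a p) = of_int a + z * eval_complex z p"
  by (simp add: eval_complex_def map_poly_pCons)

lemma eval_complex_0 [simp]: "eval_complex z 0 = 0"
  by (simp add: eval_complex_def)

lemma eval_complex_add: "eval_complex z (p + q) = eval_complex z p + eval_complex z q"
proof -
  have "map_poly of_int (p + q) = (map_poly of_int p + map_poly of_int q :: complex poly)"
    by (rule poly_eqI) (simp add: coeff_map_poly)
  then show ?thesis by (simp add: eval_complex_def)
qed

lemma eval_complex_smult: "eval_complex z (Polynomial.smult a p) = of_int a * eval_complex z p"
  by (simp add: eval_complex_def map_poly_smult)

lemma eval_complex_mult: "eval_complex z (p * q) = eval_complex z p * eval_complex z q"
  by (induction p)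
    (simp_all add: eval_complex_add eval_complex_smult eval_complex_pCons algebra_simps)

lemma eval_complex_1 [simp]: "eval_complex z 1 = 1"
  by (simp add: eval_complex_def)

lemma eval_complex_prod: "eval_complex z (prod f A) = (\<Prod>a\<in>A. eval_complex z (f a))"
  by (induction A rule: infinite_finite_induct) (simp_all add: eval_complex_mult)

definition pow_minus_1 :: "nat \<Rightarrow> int poly" where
  "pow_minus_1 d = Polynomial.monom 1 d - 1"

lemma poly_pow_minus_1: "poly (pow_minus_1 d) x = x ^ d - 1"
  by (simp add: pow_minus_1_def poly_monom)

lemma eval_complex_pow_minus_1: "eval_complex z (pow_minus_1 d) = z ^ d - 1"
proof -
  have "map_poly of_int (pow_minus_1 d) = (Polynomial.monom 1 d - 1 :: complex poly)"
    by (rule poly_eqI) (simp add: coeff_map_poly pow_minus_1_def coeff_1)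
  then show ?thesis by (simp add: eval_complex_def poly_monom)
qed

lemma pow_minus_1_dvd: "d dvd k \<Longrightarrow> pow_minus_1 d dvd pow_minus_1 k"
proof -
  assume "d dvd k"
  then obtain j where j: "k = d * j" by blast
  have "pow_minus_1 k = (Polynomial.monom 1 d) ^ j - 1"
    by (simp add: pow_minus_1_def j monom_power)
  also have "\<dots> = pow_minus_1 d * (\<Sum>i<j. Polynomial.monom 1 d ^ i)"
    by (simp add: pow_minus_1_def power_diff_1_eq)
  finally show ?thesis by (simp only: dvd_triv_left)
qed

text \<open>A primitive \<open>M\<close>-th root of unity is a root of the polynomial on the left
  but of no factor on the right.\<close>

lemma pow_minus_1_not_dvd_prod:
  assumes "0 < M"
  shows "\<not> pow_minus_1 M dvd (\<Prod>d\<in>{d. d dvd M \<and> d < M}. pow_minus_1 d)"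
proof
  assume "pow_minus_1 M dvd (\<Prod>d\<in>{d. d dvd M \<and> d < M}. pow_minus_1 d)"
  then obtain k where k: "(\<Prod>d\<in>{d. d dvd M \<and> d < M}. pow_minus_1 d) = pow_minus_1 M * k" ..
  define z where "z = cis (2 * pi / real M)"
  have pow: "z ^ d = cis (2 * pi * real d / real M)" for d by (simp add: z_def DeMoivre mult.commute)
  have "(\<Prod>d\<in>{d. d dvd M \<and> d < M}. z ^ d - 1) = (z ^ M - 1) * eval_complex z k"
    using arg_cong[OF k, of "eval_complex z"]
    by (simp add: eval_complex_prod eval_complex_mult eval_complex_pow_minus_1)
  also have "z ^ M = 1" using assms by (simp add: pow)
  finally obtain d where d: "d dvd M" "d < M" "z ^ d = 1" using assms by (auto simp: prod_zero_iff)
  have "d \<noteq> 0" using d(1) assms by auto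
  have "cos (2 * pi * real d / real M) = 1"
    using d(3) unfolding pow by (metis cis.sel(1) one_complex.sel(1))
  then obtain n :: int where "2 * pi * real d / real M = of_int n * 2 * pi"
    by (auto simp: cos_one_2pi_int)
  then have "real d = of_int n * real M" using assms by (simp add: field_simps)
  then have "int d = n * int M" by (metis of_int_eq_iff of_int_mult of_int_of_nat_eq)
  then have "int M dvd int d" by simp
  then have "M dvd d" by simp
  then show False using d(2) \<open>d \<noteq> 0\<close> by (auto dest: dvd_imp_le)
qed

text \<open>As \<open>x\<close> is 1 modulo \<open>p\<close>, the cofactor of \<open>x - 1\<close>
  in \<open>x ^ k - 1\<close> is \<open>k\<close> modulo \<open>p\<close>; so it contributes no
  factor \<open>p\<close>.\<close>

lemma prime_power_dvd_pow_minus_1: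
  fixes x :: int
  assumes p: "Factorial_Ring.prime p" "p dvd x - 1" "\<not> p dvd int k" and a: "p ^ a dvd x ^ k - 1"
  shows "p ^ a dvd x - 1"
proof -
  have "[(\<Sum>i<k. x ^ i) = (\<Sum>i<k. 1 ^ i)] (mod p)"
    using p(2) by (intro cong_sum cong_pow) (simp add: cong_iff_dvd_diff)
  then have "\<not> p dvd (\<Sum>i<k. x ^ i)"
    using p(3) by (simp add: cong_dvd_iff)
  then have "coprime (p ^ a) (\<Sum>i<k. x ^ i)"
    using p(1) by (simp add: prime_imp_coprime)
  moreover have "p ^ a dvd (x - 1) * (\<Sum>i<k. x ^ i)"
    using a by (simp add: power_diff_1_eq)
  ultimately show ?thesis by (simp add: coprime_dvd_mult_left_iff)
qed

text \<open>Let \<open>g\<close> be the part of \<open>x ^ M - 1\<close> supported on roots of unity of smaller order, and \<open>F\<close> the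
  cofactor. If no prime worked for \<open>b\<close>, a multiple of \<open>M\<close>, then every prime power dividing
  \<open>b ^ M - 1\<close> would divide \<open>g(b)\<close>, so \<open>F\<close> would only take the values \<open>1\<close> and \<open>-1\<close> at such \<open>b\<close>.\<close>
lemma prime_exact_order:
  fixes M :: nat
  assumes M: "0 < M"
  shows "\<exists>p b :: nat. Factorial_Ring.prime p \<and> [b ^ M = 1] (mod p) \<and>
    (\<forall>d. 0 < d \<longrightarrow> d < M \<longrightarrow> \<not> [b ^ d = 1] (mod p))"
proof (rule ccontr)
  assume no: "\<not> ?thesis"
  have none: "\<exists>d. 0 < d \<and> d < M \<and> [b ^ d = 1] (mod p)"
    if "Factorial_Ring.prime p" "[b ^ M = 1] (mod p)" for p b :: nat
    using no that by blast
  define D where "D = (\<Prod>d\<in>{d. d dvd M \<and> d < M}. pow_minus_1 d)"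
  define g where "g = gcd (pow_minus_1 M) D"
  \<comment> \<open>Up to sign \<open>F\<close> is the \<open>M\<close>-th cyclotomic polynomial,
    here obtained as the cofactor of a gcd.\<close>
  obtain F where F: "pow_minus_1 M = g * F" unfolding g_def by (meson dvdE gcd_dvd1)
  have fin: "finite {d. d dvd M \<and> d < M}" by simp
  have g: "pow_minus_1 d dvd g" if "d dvd M" "d < M" for d
    unfolding g_def D_def using that fin by (intro gcd_greatest pow_minus_1_dvd dvd_prodI) auto
  \<comment> \<open>Divisibility of \<open>b\<close> by \<open>M\<close> keeps the primes dividing
    \<open>b ^ M - 1\<close> from dividing \<open>M\<close>; the bound on \<open>t\<close> keeps
    \<open>b ^ M - 1\<close> nonzero.\<close>
  have F1: "poly F b * poly F b = 1" if b: "b = int (M * t)" "2 \<le> t" for b t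
  proof -
    define B where "B = M * t"
    have B: "b = int B" "2 \<le> B" using b M mult_le_mono[of 1 M 2 t] by (simp_all add: B_def)
    have "2 ^ M \<le> B ^ M" using B by (intro power_mono) auto
    moreover have "2 \<le> (2 :: nat) ^ M" using M by (cases M) auto
    ultimately have "2 \<le> B ^ M" by linarith
    have ne: "b ^ M - 1 \<noteq> 0"
    proof -
      have "int (B ^ M) \<noteq> int 1" using \<open>2 \<le> B ^ M\<close> unfolding int_int_eq by linarith
      then show ?thesis using B by simp
    qed
    have gF: "b ^ M - 1 = poly g b * poly F b"
      using arg_cong[OF F, of "\<lambda>q. poly q b"] by (simp add: poly_pow_minus_1)
    have g0: "poly g b \<noteq> 0" using gF ne by auto
    have "b ^ M - 1 dvd poly g b"
    proof (rule multiplicity_le_imp_dvd[OF ne])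
      fix p :: int assume p: "Factorial_Ring.prime p"
      show "multiplicity p (b ^ M - 1) \<le> multiplicity p (poly g b)"
      proof (cases "p dvd b ^ M - 1")
        case False
        then show ?thesis by (simp add: not_dvd_imp_multiplicity_0)
      next
        case True
        define P where "P = nat p"
        have P: "Factorial_Ring.prime P" "p = int P"
          using p by (auto simp: P_def prime_gt_0_int less_imp_le)
        have conv: "[B ^ d = 1] (mod P) \<longleftrightarrow> p dvd b ^ d - 1" for d
        proof -
          have "[B ^ d = 1] (mod P) \<longleftrightarrow> [int (B ^ d) = int 1] (mod int P)" by (simp only: cong_int_iff)
          then show ?thesis by (simp add: B P cong_iff_dvd_diff)
        qed
        obtain d where d: "0 < d" "d < M" "[B ^ d = 1] (mod P)"
          using none[OF P(1), of B] True conv by blast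
        \<comment> \<open>Passing from \<open>M\<close> to the exact order \<open>e\<close>, a
          proper divisor of \<open>M\<close>, keeps the full power of \<open>p\<close>, and
          \<open>pow_minus_1 e\<close> divides \<open>g\<close>.\<close>
        define e where "e = Pocklington.ord P B"
        have eM: "e dvd M" unfolding e_def using True conv ord_divides by blast
        have ed: "e dvd d" unfolding e_def using d ord_divides by blast
        then have eltM: "e < M" using d by (meson dvd_imp_le le_less_trans)
        have pe: "p dvd b ^ e - 1" unfolding conv[symmetric] e_def by (rule ord)
        obtain k where k: "M = e * k" using eM ..
        have "\<not> p dvd int M"
        proof
          assume "p dvd int M"
          then have "p dvd b" using b by simp
          then have "p dvd b ^ M" using M by (meson dvd_power dvd_trans)
          then have "p dvd b ^ M - (b ^ M - 1)" using True by (rule dvd_diff)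
          then show False using prime_gt_1_int[OF p] by simp
        qed
        then have pk: "\<not> p dvd int k" unfolding k by auto
        have "p ^ multiplicity p (b ^ M - 1) dvd (b ^ e) ^ k - 1"
          unfolding power_mult[symmetric] k[symmetric] by (rule multiplicity_dvd)
        then have "p ^ multiplicity p (b ^ M - 1) dvd b ^ e - 1"
          by (rule prime_power_dvd_pow_minus_1[OF p pe pk])
        also have "b ^ e - 1 dvd poly g b"
          using g[OF eM eltM] by (metis dvd_def poly_mult poly_pow_minus_1)
        finally show ?thesis
          using g0 p by (intro multiplicity_geI) auto
      qed
    qed
    then have "poly g b * poly F b dvd poly g b * 1" unfolding gF by simp
    then have "poly F b dvd 1" using g0 by (simp only: dvd_mult_cancel_left) simp
    then show ?thesis by (auto simp: zdvd1_eq abs_if split: if_splits)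
  qed
  \<comment> \<open>\<open>F * F - 1\<close> has infinitely many zeros. Once it vanishes,
    \<open>F\<close> is its own inverse and \<open>pow_minus_1 M\<close> divides \<open>g\<close>,
    hence \<open>D\<close>.\<close>
  have "F * F = 1"
  proof (rule ccontr)
    assume "F * F \<noteq> 1"
    then have "finite {x. poly (F * F - 1) x = 0}" by (intro poly_roots_finite) auto
    moreover have "(\<lambda>t. int (M * t)) ` {2..} \<subseteq> {x. poly (F * F - 1) x = 0}"
      using F1 by auto
    ultimately have "finite ((\<lambda>t. int (M * t)) ` {2..})" using finite_subset by blast
    moreover have "inj_on (\<lambda>t. int (M * t)) {2..}" using M by (auto simp: inj_on_def)
    ultimately show False using infinite_Ici[of "2 :: nat"] by (auto dest: finite_imageD)
  qed
  then have "pow_minus_1 M * F = g" using F by (simp add: mult.assoc)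
  then have "pow_minus_1 M dvd g" by (metis dvd_triv_left)
  then have "pow_minus_1 M dvd D" unfolding g_def by (meson dvd_trans gcd_dvd2)
  then show False using pow_minus_1_not_dvd_prod[OF M] by (simp add: D_def)
qed

section \<open>Reflection groups over prime fields\<close>

lemma distinct_vertices: "labelled_graph V E m \<Longrightarrow> {v, w} \<in> E \<Longrightarrow> v \<noteq> w"
  unfolding labelled_graph_def by force

text \<open>\<open>z e\<close> has order \<open>2 * m e\<close> modulo \<open>p\<close>, in the role
  of exp(pi i / m e), and \<open>z' e\<close> is its inverse. The non-congruences keep what is used
  of this: \<open>z e\<close> and \<open>z' e\<close> differ, and the commutator is nontrivial for
  labels of at least 3.\<close>

lemma exists_root_system:
  assumes "labelled_graph V E m"
  obtains p :: int and z z' where "Factorial_Ring.prime p"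
    "\<And>e. e \<in> E \<Longrightarrow> [z e * z' e = 1] (mod p)"
    "\<And>e. e \<in> E \<Longrightarrow> [z e ^ (2 * m e) = 1] (mod p)"
    "\<And>e. e \<in> E \<Longrightarrow> \<not> [z e ^ 2 = 1] (mod p)"
    "\<And>e. e \<in> E \<Longrightarrow> 3 \<le> m e \<Longrightarrow> \<not> [z e ^ 4 = 1] (mod p)"
proof -
  have m: "2 \<le> m e" if "e \<in> E" for e using assms that by (simp add: labelled_graph_def)
  have "E \<subseteq> Pow V" "finite V" using assms by (auto simp: labelled_graph_def)
  then have "finite E" by (meson finite_Pow_iff finite_subset)
  \<comment> \<open>A single prime has to serve all edges, so \<open>M\<close> is a common multiple
    of all \<open>2 * m e\<close>.\<close>
  define M where "M = 2 * (\<Prod>e\<in>E. m e)"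
  have m0: "m e \<noteq> 0" if "e \<in> E" for e using m[OF that] by simp
  then have "M \<noteq> 0" using \<open>finite E\<close> by (simp add: M_def)
  then obtain p b :: nat where p: "Factorial_Ring.prime p" and b: "[b ^ M = 1] (mod p)"
    and ord: "\<And>d. 0 < d \<Longrightarrow> d < M \<Longrightarrow> \<not> [b ^ d = 1] (mod p)"
    using prime_exact_order[of M] by blast
  define k where "k e = M div (2 * m e)" for e
  have k: "M = k e * (2 * m e)" if "e \<in> E" for e
  proof -
    have "m e dvd (\<Prod>e\<in>E. m e)" using that \<open>finite E\<close> by (rule dvd_prodI[rotated])
    then have "2 * m e dvd M" by (simp add: M_def)
    then show ?thesis by (simp add: k_def)
  qed
  have k0: "0 < k e" if "e \<in> E" for e using k[OF that] \<open>M \<noteq> 0\<close> by (cases "k e") auto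
  define z where "z e = int (b ^ k e)" for e
  define z' where "z' e = int (b ^ (M - k e))" for e
  have cong: "[int x = 1] (mod int p) \<longleftrightarrow> [x = 1] (mod p)" for x
    using cong_int_iff[of x 1 p] by simp
  show ?thesis
  proof
    show "Factorial_Ring.prime (int p)" using p by simp
    show "[z e * z' e = 1] (mod int p)" if "e \<in> E" for e
    proof -
      have "k e \<le> M" using k[OF that] m[OF that] by simp
      then have "z e * z' e = int (b ^ M)" by (simp add: z_def z'_def power_add[symmetric])
      then show ?thesis using b cong by metis
    qed
    show "[z e ^ (2 * m e) = 1] (mod int p)" if "e \<in> E" for e
    proof -
      have "z e ^ (2 * m e) = int (b ^ M)"
        by (subst k[OF that]) (simp add: z_def power_mult)
      then show ?thesis using b cong by metis
    qed
    show "\<not> [z e ^ 2 = 1] (mod int p)" if "e \<in> E" for e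
    proof -
      have "k e * 2 < M" using k[OF that] k0[OF that] m[OF that] by simp
      then have "\<not> [b ^ (k e * 2) = 1] (mod p)" using k0[OF that] by (intro ord) auto
      moreover have "z e ^ 2 = int (b ^ (k e * 2))" by (simp add: z_def power_mult)
      ultimately show ?thesis using cong by metis
    qed
    show "\<not> [z e ^ 4 = 1] (mod int p)" if "e \<in> E" "3 \<le> m e" for e
    proof -
      have "k e * 4 < M" using k[OF that(1)] k0[OF that(1)] that(2) by simp
      then have "\<not> [b ^ (k e * 4) = 1] (mod p)" using k0[OF that(1)] by (intro ord) auto
      moreover have "z e ^ 4 = int (b ^ (k e * 4))" by (simp add: z_def power_mult)
      ultimately show ?thesis using cong by metis
    qed
  qed
qed

text \<open>The geometric representation modulo \<open>p\<close>, on tuples indexed by the vertices.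
  The word \<open>[v, w, v, w]\<close> is a commutator and acts as the square of a rotation with
  eigenvalues \<open>z ^ 2\<close> and \<open>z' ^ 2\<close>; for labels of at least 3 their squares
  are not 1.\<close>

lemma reflection_action:
  fixes V :: "'a set" and m :: "'a set \<Rightarrow> nat"
  assumes lg: "labelled_graph V E m"
  shows "\<exists>(Y :: ('a \<Rightarrow> int) set) s. finite Y \<and> coxeter_action V E m Y s \<and>
    (\<forall>v w. {v, w} \<in> E \<longrightarrow> 3 \<le> m {v, w} \<longrightarrow> (\<exists>y\<in>Y. foldr s [v, w, v, w] y \<noteq> y))"
proof -
  obtain p :: int and z z' where p: "Factorial_Ring.prime p"
    and zz: "\<And>e. e \<in> E \<Longrightarrow> [z e * z' e = 1] (mod p)"
    and zm: "\<And>e. e \<in> E \<Longrightarrow> [z e ^ (2 * m e) = 1] (mod p)"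
    and z2: "\<And>e. e \<in> E \<Longrightarrow> \<not> [z e ^ 2 = 1] (mod p)"
    and z4: "\<And>e. e \<in> E \<Longrightarrow> 3 \<le> m e \<Longrightarrow> \<not> [z e ^ 4 = 1] (mod p)"
    using exists_root_system[OF lg] by metis
  have finV: "finite V" and EV: "\<And>e. e \<in> E \<Longrightarrow> e \<subseteq> V"
    using lg by (auto simp: labelled_graph_def)
  have p1: "1 < p" using p by (rule prime_gt_1_int)
  \<comment> \<open>\<open>z + z'\<close> replaces the entry \<open>2 cos (pi / m)\<close> of the geometric representation.\<close>
  define C where "C i j = (if {i, j} \<in> E then z {i, j} + z' {i, j} else 0)" for i j
  define Y where "Y = PiE V (\<lambda>_. {0..<p})"
  \<comment> \<open>Reflection in the basis vector \<open>i\<close>: only coordinate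
    \<open>i\<close> changes. Pairs without an edge have entry 0 in \<open>C\<close>, a free choice
    since they impose no relation.\<close>
  define s where "s i f = f(i := ((\<Sum>j\<in>V - {i}. C i j * f j) - f i) mod p)" for i and f :: "'a \<Rightarrow> int"
  have sY: "s i f \<in> Y" if "i \<in> V" "f \<in> Y" for i f
    using that p1 by (auto simp: s_def Y_def PiE_iff extensional_def)
  have inv: "s i (s i f) = f" if "i \<in> V" "f \<in> Y" for i f
  proof -
    have "(\<Sum>j\<in>V - {i}. C i j * s i f j) = (\<Sum>j\<in>V - {i}. C i j * f j)"
      by (rule sum.cong) (auto simp: s_def)
    moreover have "f i mod p = f i" using that by (auto simp: Y_def PiE_iff)
    ultimately show ?thesis
      unfolding s_def[of i "s i f"] by (simp add: s_def mod_simps)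
  qed
  \<comment> \<open>The letters \<open>i\<close> and \<open>j\<close> keep all other coordinates,
    whose contributions \<open>Ki\<close> and \<open>Kj\<close> make the action on the remaining
    plane affine. The congruences for \<open>x0\<close> and \<open>y0\<close> say that this point is
    fixed by both reflections.\<close>
  have track: "let g = foldr s (concat (replicate n [i, j])) f in g \<in> Y \<and> (\<forall>k. k \<noteq> i \<longrightarrow> k \<noteq> j \<longrightarrow> g k = f k) \<and>
      [(g i - x0) - z e * (g j - y0) = z' e ^ (2 * n) * ((f i - x0) - z e * (f j - y0))] (mod p) \<and>
      [(g i - x0) - z' e * (g j - y0) = z e ^ (2 * n) * ((f i - x0) - z' e * (f j - y0))] (mod p)"
    if ij: "e = {i, j}" "e \<in> E" and f: "f \<in> Y"
      and Ki: "Ki = (\<Sum>k\<in>V - {i, j}. C i k * f k)" and Kj: "Kj = (\<Sum>k\<in>V - {i, j}. C j k * f k)"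
      and x0: "[2 * x0 - (z e + z' e) * y0 = Ki] (mod p)"
      and y0: "[2 * y0 - (z e + z' e) * x0 = Kj] (mod p)"
    for i j e f x0 y0 Ki Kj n
  proof -
    have ne: "i \<noteq> j" using distinct_vertices[OF lg] ij by blast
    have V: "i \<in> V" "j \<in> V" using EV[OF ij(2)] ij by auto
    let ?z = "z e" and ?z' = "z' e"
    \<comment> \<open>Eigenfunctionals of the rotation \<open>s i \<circ> s j\<close>, centred at its fixed point \<open>(x0, y0)\<close>.\<close>
    define A where "A g = (g i - x0) - ?z * (g j - y0)" for g
    define B where "B g = (g i - x0) - ?z' * (g j - y0)" for g
    define off where "off g \<longleftrightarrow> g \<in> Y \<and> (\<forall>k. k \<noteq> i \<longrightarrow> k \<noteq> j \<longrightarrow> g k = f k)" for g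
    have Cij: "C i j = ?z + ?z'" "C j i = ?z + ?z'" using ij by (simp_all add: C_def insert_commute)
    have off_i: "off (s i g)" and off_j: "off (s j g)" if "off g" for g
      using that sY V by (auto simp: off_def) (auto simp: s_def)
    have si: "s i g i = ((?z + ?z') * g j + Ki - g i) mod p" "s i g j = g j" if "off g" for g
    proof -
      have "(\<Sum>k\<in>V - {i}. C i k * g k) = C i j * g j + (\<Sum>k\<in>V - {i} - {j}. C i k * g k)"
        by (rule sum.remove) (use V ne finV in auto)
      also have "V - {i} - {j} = V - {i, j}" by auto
      also have "(\<Sum>k\<in>V - {i, j}. C i k * g k) = Ki"
        unfolding Ki using that by (intro sum.cong) (auto simp: off_def)
      finally show "s i g i = ((?z + ?z') * g j + Ki - g i) mod p" by (simp add: s_def Cij)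
      show "s i g j = g j" using ne by (simp add: s_def)
    qed
    have sj: "s j g j = ((?z + ?z') * g i + Kj - g j) mod p" "s j g i = g i" if "off g" for g
    proof -
      have "(\<Sum>k\<in>V - {j}. C j k * g k) = C j i * g i + (\<Sum>k\<in>V - {j} - {i}. C j k * g k)"
        by (rule sum.remove) (use V ne finV in auto)
      also have "V - {j} - {i} = V - {i, j}" by auto
      also have "(\<Sum>k\<in>V - {i, j}. C j k * g k) = Kj"
        unfolding Kj using that by (intro sum.cong) (auto simp: off_def)
      finally show "s j g j = ((?z + ?z') * g i + Kj - g j) mod p" by (simp add: s_def Cij)
      show "s j g i = g i" using ne by (simp add: s_def)
    qed
    have dx: "p dvd 2 * x0 - (?z + ?z') * y0 - Ki" and dy: "p dvd 2 * y0 - (?z + ?z') * x0 - Kj"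
      and dz: "p dvd ?z * ?z' - 1"
      using x0 y0 zz[OF ij(2)] unfolding cong_iff_dvd_diff by blast+
    have mod_eq: "x mod p = x + p * (- (x div p))" for x
      by (simp add: minus_mult_div_eq_mod)
    \<comment> \<open>Each reflection inverts the rotation, so it exchanges the two eigenfunctionals
      up to a scalar.\<close>
    have Ai: "[A (s i g) = - B g] (mod p)" and Bi: "[B (s i g) = - A g] (mod p)" if "off g" for g
    proof -
      define q where "q = - (((?z + ?z') * g j + Ki - g i) div p)"
      have q: "s i g i = (?z + ?z') * g j + Ki - g i + p * q"
        unfolding q_def si(1)[OF that] by (rule mod_eq)
      have "A (s i g) - (- B g) = p * q - (2 * x0 - (?z + ?z') * y0 - Ki)"
        unfolding A_def B_def q si(2)[OF that] by (simp add: algebra_simps)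
      then show "[A (s i g) = - B g] (mod p)" using dx by (simp only: cong_iff_dvd_diff dvd_diff dvd_triv_left)
      have "B (s i g) - (- A g) = p * q - (2 * x0 - (?z + ?z') * y0 - Ki)"
        unfolding A_def B_def q si(2)[OF that] by (simp add: algebra_simps)
      then show "[B (s i g) = - A g] (mod p)" using dx by (simp only: cong_iff_dvd_diff dvd_diff dvd_triv_left)
    qed
    have Aj: "[A (s j g) = - (?z\<^sup>2 * B g)] (mod p)" and Bj: "[B (s j g) = - (?z'\<^sup>2 * A g)] (mod p)" if "off g" for g
    proof -
      define q where "q = - (((?z + ?z') * g i + Kj - g j) div p)"
      have q: "s j g j = (?z + ?z') * g i + Kj - g j + p * q"
        unfolding q_def sj(1)[OF that] by (rule mod_eq)
      have "A (s j g) - (- (?z\<^sup>2 * B g)) = - (p * (?z * q)) + ?z * (2 * y0 - (?z + ?z') * x0 - Kj)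
          - (?z * ?z' - 1) * ((g i - x0) + ?z * (g j - y0))"
        unfolding A_def B_def q sj(2)[OF that] by (simp add: algebra_simps power2_eq_square)
      then show "[A (s j g) = - (?z\<^sup>2 * B g)] (mod p)" unfolding cong_iff_dvd_diff
        using dy dz by (simp add: dvd_diff dvd_add)
      have "B (s j g) - (- (?z'\<^sup>2 * A g)) = - (p * (?z' * q)) + ?z' * (2 * y0 - (?z + ?z') * x0 - Kj)
          - (?z * ?z' - 1) * ((g i - x0) + ?z' * (g j - y0))"
        unfolding A_def B_def q sj(2)[OF that] by (simp add: algebra_simps power2_eq_square)
      then show "[B (s j g) = - (?z'\<^sup>2 * A g)] (mod p)" unfolding cong_iff_dvd_diff
        using dy dz by (simp add: dvd_diff dvd_add)
    qed
    have AT: "[A (s i (s j g)) = ?z'\<^sup>2 * A g] (mod p)" if "off g" for g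
    proof -
      have "[A (s i (s j g)) = - B (s j g)] (mod p)" by (rule Ai[OF off_j[OF that]])
      also have "[- B (s j g) = - (- (?z'\<^sup>2 * A g))] (mod p)"
        using Bj[OF that] by (simp only: cong_minus_minus_iff)
      finally show ?thesis by simp
    qed
    have BT: "[B (s i (s j g)) = ?z\<^sup>2 * B g] (mod p)" if "off g" for g
    proof -
      have "[B (s i (s j g)) = - A (s j g)] (mod p)" by (rule Bi[OF off_j[OF that]])
      also have "[- A (s j g) = - (- (?z\<^sup>2 * B g))] (mod p)"
        using Aj[OF that] by (simp only: cong_minus_minus_iff)
      finally show ?thesis by simp
    qed
    let ?g = "\<lambda>n. foldr s (concat (replicate n [i, j])) f"
    have "off (?g n) \<and> [A (?g n) = ?z' ^ (2 * n) * A f] (mod p) \<and> [B (?g n) = ?z ^ (2 * n) * B f] (mod p)"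
    proof (induction n)
      case 0
      then show ?case using f by (simp add: off_def)
    next
      case (Suc n)
      have g: "?g (Suc n) = s i (s j (?g n))" by simp
      have offn: "off (?g n)" using Suc by blast
      have "[A (?g (Suc n)) = ?z'\<^sup>2 * A (?g n)] (mod p)" unfolding g by (rule AT[OF offn])
      also have "[?z'\<^sup>2 * A (?g n) = ?z'\<^sup>2 * (?z' ^ (2 * n) * A f)] (mod p)"
        using Suc by (intro cong_mult) auto
      finally have 1: "[A (?g (Suc n)) = ?z' ^ (2 * Suc n) * A f] (mod p)"
        by (simp add: power2_eq_square mult.assoc)
      have "[B (?g (Suc n)) = ?z\<^sup>2 * B (?g n)] (mod p)" unfolding g by (rule BT[OF offn])
      also have "[?z\<^sup>2 * B (?g n) = ?z\<^sup>2 * (?z ^ (2 * n) * B f)] (mod p)"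
        using Suc by (intro cong_mult) auto
      finally have 2: "[B (?g (Suc n)) = ?z ^ (2 * Suc n) * B f] (mod p)"
        by (simp add: power2_eq_square mult.assoc)
      show ?case using 1 2 off_i[OF off_j[OF offn]] g by simp
    qed
    then show ?thesis by (simp add: A_def B_def off_def Let_def)
  qed
  have zz_pow: "[z e ^ k * z' e ^ k = 1] (mod p)" if "e \<in> E" for e k
    using cong_pow[OF zz[OF that], of k] by (simp add: power_mult_distrib)
  have rel: "foldr s (concat (replicate (m {i, j}) [i, j])) f = f" if ij: "{i, j} \<in> E" and f: "f \<in> Y" for i j f
  proof -
    define e where "e = {i, j}"
    have e: "e \<in> E" using ij by (simp add: e_def)
    let ?z = "z e" and ?z' = "z' e" and ?C = "z e + z' e"
    have dz: "p dvd ?z * ?z' - 1" using zz[OF e] by (simp add: cong_iff_dvd_diff)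
    have nd: "\<not> p dvd ?z - ?z'"
    proof
      assume "p dvd ?z - ?z'"
      then have "p dvd ?z * (?z - ?z') + (?z * ?z' - 1)" using dz by (simp add: dvd_add)
      moreover have "?z * (?z - ?z') + (?z * ?z' - 1) = ?z\<^sup>2 - 1" by (simp add: algebra_simps power2_eq_square)
      ultimately show False using z2[OF e] by (simp add: cong_iff_dvd_diff)
    qed
    \<comment> \<open>The determinant of the linear system for the fixed point. As
      \<open>?z * ?z'\<close> is 1 modulo \<open>p\<close>, it is minus the square of
      \<open>?z - ?z'\<close>.\<close>
    have "\<not> p dvd 4 - ?C\<^sup>2"
    proof
      assume "p dvd 4 - ?C\<^sup>2"
      then have "p dvd (4 - ?C\<^sup>2) + 4 * (?z * ?z' - 1)" by (rule dvd_add[OF _ dvd_mult[OF dz]])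
      moreover have "(4 - ?C\<^sup>2) + 4 * (?z * ?z' - 1) = - ((?z - ?z') * (?z - ?z'))"
        by (simp add: algebra_simps power2_eq_square)
      ultimately show False using nd p by (simp add: prime_dvd_mult_iff)
    qed
    then have "coprime (4 - ?C\<^sup>2) p" using p by (metis coprime_commute prime_imp_coprime)
    then obtain u where u: "[(4 - ?C\<^sup>2) * u = 1] (mod p)" using cong_solve_coprime_int by blast
    define Ki where "Ki = (\<Sum>k\<in>V - {i, j}. C i k * f k)"
    define Kj where "Kj = (\<Sum>k\<in>V - {i, j}. C j k * f k)"
    \<comment> \<open>Cramer's rule, with \<open>u\<close> the inverse of the determinant.\<close>
    define x0 where "x0 = u * (2 * Ki + ?C * Kj)"
    define y0 where "y0 = u * (2 * Kj + ?C * Ki)"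
    have "2 * x0 - ?C * y0 = (4 - ?C\<^sup>2) * u * Ki"
      by (simp add: x0_def y0_def algebra_simps power2_eq_square)
    then have x0: "[2 * x0 - ?C * y0 = Ki] (mod p)" using cong_scalar_right[OF u, of Ki] by simp
    have "2 * y0 - ?C * x0 = (4 - ?C\<^sup>2) * u * Kj"
      by (simp add: x0_def y0_def algebra_simps power2_eq_square)
    then have y0: "[2 * y0 - ?C * x0 = Kj] (mod p)" using cong_scalar_right[OF u, of Kj] by simp
    define g where "g = foldr s (concat (replicate (m e) [i, j])) f"
    have zm': "[?z' ^ (2 * m e) = 1] (mod p)"
    proof -
      have "[1 * ?z' ^ (2 * m e) = ?z ^ (2 * m e) * ?z' ^ (2 * m e)] (mod p)"
        using zm[OF e] by (intro cong_mult) (auto simp: cong_sym)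
      also have "[?z ^ (2 * m e) * ?z' ^ (2 * m e) = 1] (mod p)" by (rule zz_pow[OF e])
      finally show ?thesis by simp
    qed
    note tr = track[OF e_def e f Ki_def Kj_def x0 y0, of "m e", unfolded Let_def]
    have gY: "g \<in> Y" and goff: "\<And>k. k \<noteq> i \<Longrightarrow> k \<noteq> j \<Longrightarrow> g k = f k"
      and A: "[(g i - x0) - ?z * (g j - y0) = ?z' ^ (2 * m e) * ((f i - x0) - ?z * (f j - y0))] (mod p)"
      and B: "[(g i - x0) - ?z' * (g j - y0) = ?z ^ (2 * m e) * ((f i - x0) - ?z' * (f j - y0))] (mod p)"
      using tr unfolding g_def by blast+
    have A': "p dvd (g i - x0) - ?z * (g j - y0) - ((f i - x0) - ?z * (f j - y0))"
      using cong_trans[OF A cong_scalar_right[OF zm']] by (simp add: cong_iff_dvd_diff)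
    have B': "p dvd (g i - x0) - ?z' * (g j - y0) - ((f i - x0) - ?z' * (f j - y0))"
      using cong_trans[OF B cong_scalar_right[OF zm[OF e]]] by (simp add: cong_iff_dvd_diff)
    have "p dvd (?z - ?z') * (g j - f j)"
      using dvd_diff[OF B' A'] by (simp add: algebra_simps)
    then have dj: "p dvd g j - f j" using nd p by (simp add: prime_dvd_mult_iff)
    have "g i - f i = ((g i - x0) - ?z * (g j - y0) - ((f i - x0) - ?z * (f j - y0))) + ?z * (g j - f j)"
      by (simp add: algebra_simps)
    then have di: "p dvd g i - f i" using A' dj by (metis dvd_add dvd_mult)
    have V: "i \<in> V" "j \<in> V" using EV[OF e] by (auto simp: e_def)
    have range: "h k mod p = h k" if "h \<in> Y" "k \<in> V" for h k using that by (auto simp: Y_def PiE_iff)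
    have "g i = f i" "g j = f j"
      using di dj range[OF gY] range[OF f] V by (metis mod_eq_dvd_iff)+
    then have "g = f" using goff by (auto simp: fun_eq_iff) metis
    then show ?thesis by (simp add: g_def e_def)
  qed
  have "coxeter_action V E m Y s"
    unfolding coxeter_action_def coxeter_relators_def using sY inv rel by auto
  moreover have "finite Y" using finV by (auto simp: Y_def intro: finite_PiE)
  moreover have "\<exists>y\<in>Y. foldr s [v, w, v, w] y \<noteq> y" if vw: "{v, w} \<in> E" "3 \<le> m {v, w}" for v w
  proof -
    define e where "e = {v, w}"
    have e: "e \<in> E" using vw by (simp add: e_def)
    have V: "v \<in> V" "w \<in> V" using EV[OF e] by (auto simp: e_def)
    have ne: "v \<noteq> w" using distinct_vertices[OF lg vw(1)] .
    \<comment> \<open>The basis vector \<open>v\<close>: the offsets vanish, 0 is the fixed point,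
      and the first functional has the value 1 at \<open>f\<close> but \<open>z' ^ 4\<close> after
      two rotations.\<close>
    define f where "f = (\<lambda>k\<in>V. if k = v then 1 else 0 :: int)"
    have f: "f \<in> Y" using p1 by (auto simp: f_def Y_def)
    have fv: "f v = 1" "f w = 0" using V ne by (simp_all add: f_def)
    have K: "0 = (\<Sum>k\<in>V - {v, w}. C v k * f k)" "0 = (\<Sum>k\<in>V - {v, w}. C w k * f k)"
      by (simp_all add: f_def)
    have word: "concat (replicate 2 [v, w]) = [v, w, v, w]" by (simp add: numeral_2_eq_2)
    define g where "g = foldr s [v, w, v, w] f"
    note tr = track[OF e_def e f K, of 0 0 2, unfolded Let_def word]
    have A: "[g v - z e * g w = z' e ^ 4 * (f v - z e * f w)] (mod p)"
      using tr unfolding g_def by simp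
    have "g \<noteq> f"
    proof
      assume "g = f"
      then have 1: "[1 = z' e ^ 4] (mod p)" using A fv by simp
      have "[z e ^ 4 * 1 = z e ^ 4 * z' e ^ 4] (mod p)" using 1 by (rule cong_scalar_left)
      also have "[z e ^ 4 * z' e ^ 4 = 1] (mod p)" by (rule zz_pow[OF e])
      finally show False using z4[OF e] vw by (simp add: e_def)
    qed
    then show ?thesis using f unfolding g_def by blast
  qed
  ultimately show ?thesis by blast
qed

section \<open>Recovering a graph from its cliques\<close>

definition clique :: "'a set \<Rightarrow> 'a set set \<Rightarrow> 'a set \<Rightarrow> bool" where
  "clique V E C \<longleftrightarrow> C \<subseteq> V \<and> (\<forall>x\<in>C. \<forall>y\<in>C. x \<noteq> y \<longrightarrow> {x, y} \<in> E)"

definition maxclique :: "'a set \<Rightarrow> 'a set set \<Rightarrow> 'a set \<Rightarrow> bool" where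
  "maxclique V E C \<longleftrightarrow> clique V E C \<and> (\<forall>D. clique V E D \<longrightarrow> C \<subseteq> D \<longrightarrow> C = D)"

text \<open>\<open>Pow V\<close> under symmetric difference is the vector space over the field with
  two elements with basis \<open>V\<close>, so \<open>f\<close> is a linear isomorphism between the
  abelianisations.\<close>

definition clique_iso :: "'a set \<Rightarrow> 'a set set \<Rightarrow> 'b set \<Rightarrow> 'b set set \<Rightarrow> ('a set \<Rightarrow> 'b set) \<Rightarrow> bool" where
  "clique_iso V E V' E' f \<longleftrightarrow> bij_betw f (Pow V) (Pow V') \<and>
     (\<forall>S T. S \<subseteq> V \<longrightarrow> T \<subseteq> V \<longrightarrow> f (sym_diff S T) = sym_diff (f S) (f T)) \<and>
     (\<forall>S. S \<subseteq> V \<longrightarrow> clique V E S = clique V' E' (f S))"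

text \<open>If \<open>x\<close> lies only in \<open>S\<close> and \<open>y\<close> only in
  \<open>T\<close>, both lie in the symmetric difference. So a subspace of cliques lies in the power
  set of a single clique, which identifies the maximal subspaces of cliques with the maximal
  cliques.\<close>

lemma clique_Union:
  assumes "\<And>S. S \<in> A \<Longrightarrow> clique V E S" "\<And>S T. S \<in> A \<Longrightarrow> T \<in> A \<Longrightarrow> sym_diff S T \<in> A"
  shows "clique V E (\<Union>A)"
  unfolding clique_def
proof (intro conjI ballI impI)
  show "\<Union>A \<subseteq> V" using assms(1) by (auto simp: clique_def)
  fix x y assume "x \<in> \<Union>A" "y \<in> \<Union>A" and ne: "x \<noteq> y"
  then obtain S T where S: "S \<in> A" "x \<in> S" and T: "T \<in> A" "y \<in> T" by blast
  show "{x, y} \<in> E"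
  proof (cases "y \<in> S \<or> x \<in> T")
    case True
    then show ?thesis using assms(1)[OF S(1)] assms(1)[OF T(1)] S T ne by (auto simp: clique_def)
  next
    case False
    then have "x \<in> sym_diff S T" "y \<in> sym_diff S T" using S T by auto
    then show ?thesis using assms(1)[OF assms(2)[OF S(1) T(1)]] ne by (auto simp: clique_def)
  qed
qed

lemma clique_mono: "clique V E C \<Longrightarrow> D \<subseteq> C \<Longrightarrow> clique V E D"
  by (auto simp: clique_def)

lemma clique_extends:
  assumes "finite V" "clique V E D"
  obtains C where "maxclique V E C" "D \<subseteq> C"
proof -
  have "finite {C. clique V E C}"
    by (rule finite_subset[of _ "Pow V"]) (use assms(1) in \<open>auto simp: clique_def\<close>)
  from finite_has_maximal2[OF this, of D] assms(2) obtain C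
    where "clique V E C" "D \<subseteq> C" "\<forall>B. clique V E B \<longrightarrow> C \<subseteq> B \<longrightarrow> C = B" by auto
  then show ?thesis using that by (simp add: maxclique_def)
qed

lemma sym_diff_subset: "S \<subseteq> C \<Longrightarrow> T \<subseteq> C \<Longrightarrow> sym_diff S T \<subseteq> C"
  by auto

lemma clique_iso_inv:
  assumes "clique_iso V E V' E' f"
  shows "clique_iso V' E' V E (inv_into (Pow V) f)"
proof -
  let ?g = "inv_into (Pow V) f"
  have f: "bij_betw f (Pow V) (Pow V')"
    and add: "\<And>S T. S \<subseteq> V \<Longrightarrow> T \<subseteq> V \<Longrightarrow> f (sym_diff S T) = sym_diff (f S) (f T)"
    and cl: "\<And>S. S \<subseteq> V \<Longrightarrow> clique V E S = clique V' E' (f S)"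
    using assms by (auto simp: clique_iso_def)
  have g: "bij_betw ?g (Pow V') (Pow V)" by (rule bij_betw_inv_into[OF f])
  have gV: "?g S \<subseteq> V" if "S \<subseteq> V'" for S using bij_betwE[OF g] that by blast
  have fg: "f (?g S) = S" if "S \<subseteq> V'" for S using bij_betw_inv_into_right[OF f] that by simp
  have gf: "?g (f S) = S" if "S \<subseteq> V" for S using bij_betw_inv_into_left[OF f] that by simp
  have "?g (sym_diff S T) = sym_diff (?g S) (?g T)" if "S \<subseteq> V'" "T \<subseteq> V'" for S T
  proof -
    have "f (sym_diff (?g S) (?g T)) = sym_diff S T" using that by (simp add: add gV fg)
    then show ?thesis using gf[OF sym_diff_subset[OF gV[OF that(1)] gV[OF that(2)]]] by simp
  qed
  then show ?thesis using g cl gV fg by (auto simp: clique_iso_def)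
qed

text \<open>The image of \<open>Pow C\<close> is again a subspace of cliques, so its union is a
  clique. For a clique above that union, the preimage of its power set is a subspace of cliques
  whose union contains \<open>C\<close> and hence equals \<open>C\<close>.\<close>

lemma clique_iso_maxclique:
  assumes iso: "clique_iso V E V' E' f" and C: "maxclique V E C"
  shows "maxclique V' E' (\<Union>(f ` Pow C))" "f ` Pow C = Pow (\<Union>(f ` Pow C))"
proof -
  let ?C' = "\<Union>(f ` Pow C)"
  have f: "bij_betw f (Pow V) (Pow V')"
    and add: "\<And>S T. S \<subseteq> V \<Longrightarrow> T \<subseteq> V \<Longrightarrow> f (sym_diff S T) = sym_diff (f S) (f T)"
    and cl: "\<And>S. S \<subseteq> V \<Longrightarrow> clique V E S = clique V' E' (f S)"
    using iso by (auto simp: clique_iso_def)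
  have cC: "clique V E C" and CV: "C \<subseteq> V" using C by (auto simp: maxclique_def clique_def)
  have C': "clique V' E' ?C'"
  proof (rule clique_Union)
    fix S assume "S \<in> f ` Pow C"
    then show "clique V' E' S" using cl clique_mono[OF cC] CV by blast
  next
    fix S T assume "S \<in> f ` Pow C" "T \<in> f ` Pow C"
    then obtain A B where A: "A \<subseteq> C" "S = f A" and B: "B \<subseteq> C" "T = f B" by blast
    then have "sym_diff S T = f (sym_diff A B)" using add CV by simp
    then show "sym_diff S T \<in> f ` Pow C" using sym_diff_subset[OF A(1) B(1)] by simp
  qed
  \<comment> \<open>Used twice: for larger cliques \<open>D\<close> it gives maximality, and for
    \<open>D = ?C'\<close> the second claim.\<close>
  have key: "D \<subseteq> ?C' \<and> Pow D \<subseteq> f ` Pow C" if D: "clique V' E' D" "?C' \<subseteq> D" for D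
  proof -
    define B where "B = {S. S \<subseteq> V \<and> f S \<subseteq> D}"
    have "clique V E (\<Union>B)"
    proof (rule clique_Union)
      show "clique V E S" if "S \<in> B" for S
        using that cl clique_mono[OF D(1)] by (auto simp: B_def)
      show "sym_diff S T \<in> B" if "S \<in> B" "T \<in> B" for S T
        using that add sym_diff_subset by (auto simp: B_def)
    qed
    moreover have "C \<in> B" using D(2) CV by (auto simp: B_def)
    ultimately have UB: "\<Union>B = C" using C by (auto simp: maxclique_def)
    have DV: "D \<subseteq> V'" using D(1) by (simp add: clique_def)
    have "T \<in> f ` Pow C" if "T \<subseteq> D" for T
    proof -
      have "T \<in> f ` Pow V" using f that DV by (simp add: bij_betw_def)
      then obtain S where S: "S \<subseteq> V" "T = f S" by blast
      then have "S \<in> B" using that by (simp add: B_def)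
      then show ?thesis using UB S by blast
    qed
    then show ?thesis by blast
  qed
  show "maxclique V' E' ?C'" unfolding maxclique_def using C' key by blast
  show "f ` Pow C = Pow ?C'" using key[OF C'] by blast
qed

lemma bij_betw_of_fibre_cards:
  assumes "finite V" "finite V'"
    and card: "\<And>t. card {v \<in> V. \<tau> v = t} = card {v \<in> V'. \<tau>' v = t}"
  obtains \<phi> where "bij_betw \<phi> V V'" "\<And>v. v \<in> V \<Longrightarrow> \<tau>' (\<phi> v) = \<tau> v"
proof -
  have "\<exists>h. bij_betw h {v \<in> V. \<tau> v = t} {v \<in> V'. \<tau>' v = t}" for t
    using assms by (intro finite_same_card_bij) auto
  then obtain h where h: "\<And>t. bij_betw (h t) {v \<in> V. \<tau> v = t} {v \<in> V'. \<tau>' v = t}" by metis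
  define \<phi> where "\<phi> v = h (\<tau> v) v" for v
  have \<phi>: "\<phi> v \<in> V'" "\<tau>' (\<phi> v) = \<tau> v" if "v \<in> V" for v
    using bij_betwE[OF h[of "\<tau> v"]] that by (auto simp: \<phi>_def)
  have "bij_betw \<phi> V V'"
    unfolding bij_betw_def
  proof
    show "inj_on \<phi> V"
    proof (rule inj_onI)
      fix v w assume vw: "v \<in> V" "w \<in> V" "\<phi> v = \<phi> w"
      then have t: "\<tau> v = \<tau> w" using \<phi> by metis
      then have "h (\<tau> w) v = h (\<tau> w) w" using vw by (simp add: \<phi>_def)
      then show "v = w" using bij_betw_imp_inj_on[OF h[of "\<tau> w"]] vw t by (auto dest: inj_onD)
    qed
    show "\<phi> ` V = V'"
    proof
      show "V' \<subseteq> \<phi> ` V"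
      proof
        fix v' assume "v' \<in> V'"
        then have "v' \<in> h (\<tau>' v') ` {v \<in> V. \<tau> v = \<tau>' v'}"
          using bij_betw_imp_surj_on[OF h[of "\<tau>' v'"]] by simp
        then obtain v where "v \<in> V" "\<tau> v = \<tau>' v'" "v' = h (\<tau>' v') v" by blast
        then show "v' \<in> \<phi> ` V" by (intro image_eqI[of _ _ v]) (simp_all add: \<phi>_def)
      qed
    qed (use \<phi> in auto)
  qed
  then show ?thesis using \<phi>(2) by (rule that)
qed

text \<open>Moebius inversion over the subsets of \<open>M\<close>, carried out from large
  \<open>t\<close> to small \<open>t\<close>: subtracting the exact counts of the proper supersets
  leaves the exact count of \<open>t\<close>.\<close>

lemma fibre_cards_of_upset_cards:
  assumes fin: "finite M" "finite V" "finite V'"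
    and \<tau>: "\<And>v. v \<in> V \<Longrightarrow> \<tau> v \<subseteq> M" and \<tau>': "\<And>v. v \<in> V' \<Longrightarrow> \<tau>' v \<subseteq> M"
    and card: "\<And>t. t \<subseteq> M \<Longrightarrow> card {v \<in> V. t \<subseteq> \<tau> v} = card {v \<in> V'. t \<subseteq> \<tau>' v}"
  shows "card {v \<in> V. \<tau> v = t} = card {v \<in> V'. \<tau>' v = t}"
proof (cases "t \<subseteq> M")
  case True
  then show ?thesis
  proof (induction "card (M - t)" arbitrary: t rule: less_induct)
    case less
    define U where "U = {u. t \<subset> u \<and> u \<subseteq> M}"
    have finU: "finite U" by (rule finite_subset[of _ "Pow M"]) (use fin in \<open>auto simp: U_def\<close>)
    have split: "card {v \<in> A. t \<subseteq> r v} = card {v \<in> A. r v = t} + (\<Sum>u\<in>U. card {v \<in> A. r v = u})"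
      if "finite A" and r: "\<And>v. v \<in> A \<Longrightarrow> r v \<subseteq> M" for A :: "'x set" and r
    proof -
      have "{v \<in> A. t \<subseteq> r v} = {v \<in> A. r v = t} \<union> (\<Union>u\<in>U. {v \<in> A. r v = u})"
        using r by (auto simp: U_def)
      moreover have "card (\<Union>u\<in>U. {v \<in> A. r v = u}) = (\<Sum>u\<in>U. card {v \<in> A. r v = u})"
        by (rule card_UN_disjoint) (use finU that(1) in auto)
      moreover have "card ({v \<in> A. r v = t} \<union> (\<Union>u\<in>U. {v \<in> A. r v = u})) =
          card {v \<in> A. r v = t} + card (\<Union>u\<in>U. {v \<in> A. r v = u})"
        by (rule card_Un_disjoint) (use finU that(1) in \<open>auto simp: U_def\<close>)
      ultimately show ?thesis by simp
    qed
    have IH: "card {v \<in> V. \<tau> v = u} = card {v \<in> V'. \<tau>' v = u}" if "u \<in> U" for u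
    proof (rule less.hyps)
      show "u \<subseteq> M" using that by (simp add: U_def)
      have "M - u \<subset> M - t" using that by (auto simp: U_def)
      then show "card (M - u) < card (M - t)" using fin(1) by (intro psubset_card_mono) auto
    qed
    then have "(\<Sum>u\<in>U. card {v \<in> V. \<tau> v = u}) = (\<Sum>u\<in>U. card {v \<in> V'. \<tau>' v = u})"
      by (intro sum.cong) auto
    then show ?case
      using split[OF fin(2) \<tau>] split[OF fin(3) \<tau>'] card[OF less.prems] by simp
  qed
next
  case False
  then have "{v \<in> V. \<tau> v = t} = {}" "{v \<in> V'. \<tau>' v = t} = {}" using \<tau> \<tau>' by auto
  then show ?thesis by (simp only: card.empty)
qed

text \<open>\<open>f\<close> need not map singletons to singletons, so it does not match vertices
  itself. But it maps the power set of an intersection of maximal cliques onto the power set of the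
  corresponding intersection, so the two have the same size. Adjacency is recovered as membership in
  a common maximal clique.\<close>

lemma graph_iso_of_clique_iso:
  assumes fin: "finite V" "finite V'" and iso: "clique_iso V E V' E' f"
  obtains \<phi> where "bij_betw \<phi> V V'"
    "\<And>x y. x \<in> V \<Longrightarrow> y \<in> V \<Longrightarrow> x \<noteq> y \<Longrightarrow> {x, y} \<in> E \<longleftrightarrow> {\<phi> x, \<phi> y} \<in> E'"
proof -
  define M where "M = {C. maxclique V E C}"
  define F where "F C = \<Union>(f ` Pow C)" for C
  define g where "g = inv_into (Pow V) f"
  have f: "bij_betw f (Pow V) (Pow V')" using iso by (simp add: clique_iso_def)
  have iso': "clique_iso V' E' V E g" unfolding g_def by (rule clique_iso_inv[OF iso])
  have MV: "C \<subseteq> V" if "C \<in> M" for C using that by (auto simp: M_def maxclique_def clique_def)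
  have finM: "finite M" by (rule finite_subset[of _ "Pow V"]) (use fin MV in auto)
  have F: "maxclique V' E' (F C)" "f ` Pow C = Pow (F C)" if "C \<in> M" for C
    using clique_iso_maxclique[OF iso, of C] that by (simp_all add: M_def F_def)
  have onto: "\<exists>C\<in>M. F C = C'" if C': "maxclique V' E' C'" for C'
  proof -
    define C where "C = \<Union>(g ` Pow C')"
    have C: "C \<in> M" "g ` Pow C' = Pow C"
      using clique_iso_maxclique[OF iso' C'] by (simp_all add: M_def C_def)
    have C'V: "C' \<subseteq> V'" using C' by (simp add: maxclique_def clique_def)
    have "Pow (F C) = f ` g ` Pow C'" using F(2)[OF C(1)] C(2) by simp
    also have "\<dots> = Pow C'"
      unfolding g_def by (rule image_inv_into_cancel[OF bij_betw_imp_surj_on[OF f]]) (use C'V in auto)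
    finally have "\<Union>(Pow (F C)) = \<Union>(Pow C')" by simp
    then show ?thesis using C(1) by auto
  qed
  \<comment> \<open>The type of a vertex is the set of maximal cliques containing it. Through
    \<open>F\<close> both graphs use \<open>M\<close> as index set, so types can be
    compared.\<close>
  define \<tau> where "\<tau> v = {C \<in> M. v \<in> C}" for v
  define \<tau>' where "\<tau>' v = {C \<in> M. v \<in> F C}" for v
  have card: "card {v \<in> V. t \<subseteq> \<tau> v} = card {v \<in> V'. t \<subseteq> \<tau>' v}" if t: "t \<subseteq> M" for t
  proof -
    have 1: "S \<subseteq> {v \<in> V. t \<subseteq> \<tau> v} \<longleftrightarrow> f S \<subseteq> {v \<in> V'. t \<subseteq> \<tau>' v}" if S: "S \<subseteq> V" for S
    proof -
      have fS: "f S \<subseteq> V'" using bij_betwE[OF f] S by blast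
      have "S \<subseteq> C \<longleftrightarrow> f S \<subseteq> F C" if C: "C \<in> M" for C
      proof -
        have "f S \<in> f ` Pow C \<longleftrightarrow> S \<in> Pow C"
          by (rule inj_on_image_mem_iff[OF bij_betw_imp_inj_on[OF f]]) (use S MV[OF C] in auto)
        then show ?thesis using F(2)[OF C] by auto
      qed
      then have "(\<forall>C\<in>t. S \<subseteq> C) \<longleftrightarrow> (\<forall>C\<in>t. f S \<subseteq> F C)" using t by blast
      moreover have "S \<subseteq> {v \<in> V. t \<subseteq> \<tau> v} \<longleftrightarrow> (\<forall>C\<in>t. S \<subseteq> C)"
        using S t by (auto simp: \<tau>_def)
      moreover have "f S \<subseteq> {v \<in> V'. t \<subseteq> \<tau>' v} \<longleftrightarrow> (\<forall>C\<in>t. f S \<subseteq> F C)"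
        using fS t by (auto simp: \<tau>'_def)
      ultimately show ?thesis by blast
    qed
    have "f ` Pow {v \<in> V. t \<subseteq> \<tau> v} = Pow {v \<in> V'. t \<subseteq> \<tau>' v}"
    proof
      show "f ` Pow {v \<in> V. t \<subseteq> \<tau> v} \<subseteq> Pow {v \<in> V'. t \<subseteq> \<tau>' v}"
      proof
        fix T assume "T \<in> f ` Pow {v \<in> V. t \<subseteq> \<tau> v}"
        then obtain S where S: "S \<subseteq> {v \<in> V. t \<subseteq> \<tau> v}" "T = f S" by blast
        then have "S \<subseteq> V" by blast
        then show "T \<in> Pow {v \<in> V'. t \<subseteq> \<tau>' v}" using 1 S by blast
      qed
      show "Pow {v \<in> V'. t \<subseteq> \<tau>' v} \<subseteq> f ` Pow {v \<in> V. t \<subseteq> \<tau> v}"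
      proof
        fix T assume T: "T \<in> Pow {v \<in> V'. t \<subseteq> \<tau>' v}"
        then have "T \<in> f ` Pow V" using bij_betw_imp_surj_on[OF f] by blast
        then obtain S where S: "S \<subseteq> V" "T = f S" by blast
        then show "T \<in> f ` Pow {v \<in> V. t \<subseteq> \<tau> v}" using 1[OF S(1)] T by blast
      qed
    qed
    moreover have "inj_on f (Pow {v \<in> V. t \<subseteq> \<tau> v})"
      by (rule inj_on_subset[OF bij_betw_imp_inj_on[OF f]]) auto
    ultimately have "card (Pow {v \<in> V. t \<subseteq> \<tau> v}) = card (Pow {v \<in> V'. t \<subseteq> \<tau>' v})"
      by (metis card_image)
    then show ?thesis using fin by (simp add: card_Pow)
  qed
  have "card {v \<in> V. \<tau> v = t} = card {v \<in> V'. \<tau>' v = t}" for t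
    by (rule fibre_cards_of_upset_cards[OF finM fin _ _ card]) (auto simp: \<tau>_def \<tau>'_def)
  then obtain \<phi> where \<phi>: "bij_betw \<phi> V V'" "\<And>v. v \<in> V \<Longrightarrow> \<tau>' (\<phi> v) = \<tau> v"
    using bij_betw_of_fibre_cards[OF fin, of \<tau> \<tau>'] by blast
  have edge: "{x, y} \<in> E0 \<longleftrightarrow> (\<exists>C. maxclique V0 E0 C \<and> x \<in> C \<and> y \<in> C)"
    if fin0: "finite V0" and xy0: "x \<in> V0" "y \<in> V0" "x \<noteq> y" for V0 :: "'x set" and E0 x y
  proof
    assume "{x, y} \<in> E0"
    then have "clique V0 E0 {x, y}" using xy0 by (auto simp: clique_def insert_commute)
    then obtain C where "maxclique V0 E0 C" "{x, y} \<subseteq> C" by (rule clique_extends[OF fin0])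
    then show "\<exists>C. maxclique V0 E0 C \<and> x \<in> C \<and> y \<in> C" by blast
  qed (use xy0 in \<open>auto simp: maxclique_def clique_def\<close>)
  have "{x, y} \<in> E \<longleftrightarrow> {\<phi> x, \<phi> y} \<in> E'" if xy: "x \<in> V" "y \<in> V" "x \<noteq> y" for x y
  proof -
    have \<phi>V: "\<phi> x \<in> V'" "\<phi> y \<in> V'" "\<phi> x \<noteq> \<phi> y"
      using bij_betwE[OF \<phi>(1)] bij_betw_imp_inj_on[OF \<phi>(1)] xy by (auto dest: inj_onD)
    have "{x, y} \<in> E \<longleftrightarrow> \<tau> x \<inter> \<tau> y \<noteq> {}"
      using edge[OF fin(1) xy, of E] by (auto simp: \<tau>_def M_def)
    also have "\<dots> \<longleftrightarrow> \<tau>' (\<phi> x) \<inter> \<tau>' (\<phi> y) \<noteq> {}" using \<phi>(2) xy by simp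
    also have "\<dots> \<longleftrightarrow> (\<exists>C. maxclique V' E' C \<and> \<phi> x \<in> C \<and> \<phi> y \<in> C)"
      using F(1) onto unfolding \<tau>'_def by blast
    also have "\<dots> \<longleftrightarrow> {\<phi> x, \<phi> y} \<in> E'" using edge[OF fin(2) \<phi>V, of E'] by simp
    finally show ?thesis .
  qed
  then show ?thesis using \<phi>(1) by (rule_tac that) auto
qed

section \<open>Reduction to right-angled groups\<close>

lemma action_relators_factor:
  assumes R: "factors_reps V E m (BijGroup Y) R" "onto_rep V E m R c"
    and act: "coxeter_action V E m Y s"
    and xs: "set xs \<subseteq> V" "set ys \<subseteq> V" "eval_word R c xs = eval_word R c ys" and y: "y \<in> Y"
  shows "foldr s xs y = foldr s ys y"
proof -
  have "eval_word (BijGroup Y) (\<lambda>v. restrict (s v) Y) xs = eval_word (BijGroup Y) (\<lambda>v. restrict (s v) Y) ys"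
    by (rule factors_repsD[OF R coxeter_action_rep(1)[OF act] xs])
  then have "restrict (foldr s xs) Y = restrict (foldr s ys) Y"
    unfolding coxeter_action_rep(2)[OF act xs(1)] coxeter_action_rep(2)[OF act xs(2)] .
  then show ?thesis unfolding restrict_eq_restrict_iff using y by blast
qed

lemma rep_commute:
  assumes "right_angled E m" "group R" "coxeter_rep V E m R c"
    and vw: "v \<in> V" "w \<in> V" "{v, w} \<in> E"
  shows "c v \<otimes>\<^bsub>R\<^esub> c w = c w \<otimes>\<^bsub>R\<^esub> c v"
proof -
  interpret group R by fact
  have c: "c v \<in> carrier R" "c w \<in> carrier R" using assms(3) vw by (auto simp: coxeter_rep_def)
  have "m {v, w} = 2" using assms(1) vw by (simp add: right_angled_def)
  then have "concat (replicate 2 [v, w]) \<in> coxeter_relators V E m"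
    using vw unfolding coxeter_relators_def by force
  then have "eval_word R c (concat (replicate 2 [v, w])) = \<one>\<^bsub>R\<^esub>" by (rule coxeter_repD(2)[OF assms(3)])
  then have "(c v \<otimes>\<^bsub>R\<^esub> c w) \<otimes>\<^bsub>R\<^esub> (c v \<otimes>\<^bsub>R\<^esub> c w) = \<one>\<^bsub>R\<^esub>"
    using c by (simp add: numeral_2_eq_2 m_assoc)
  then have "c v \<otimes>\<^bsub>R\<^esub> c w = inv\<^bsub>R\<^esub> (c v \<otimes>\<^bsub>R\<^esub> c w)" using c by (metis inv_equality m_closed)
  also have "\<dots> = inv\<^bsub>R\<^esub> (c w) \<otimes>\<^bsub>R\<^esub> inv\<^bsub>R\<^esub> (c v)" using c by (rule inv_mult_group)
  also have "\<dots> = c w \<otimes>\<^bsub>R\<^esub> c v"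
    using rep_involution[OF assms(3) vw(1)] rep_involution[OF assms(3) vw(2)] c by (simp add: inv_equality)
  finally show ?thesis .
qed

text \<open>\<open>R1\<close> detects the reflection action, and \<open>R\<close> refines
  \<open>R1\<close> so that even words with trivial \<open>n\<close>-th power in \<open>R\<close>
  die in \<open>R1\<close>. The commutator of the end points of a bad edge is such an element, so it
  acts trivially, contrary to \<open>reflection_action\<close>. The surjection of \<open>W'\<close>
  onto \<open>R1\<close> through \<open>R\<close> need not be the one that came with
  \<open>R1\<close>; \<open>factors_reps\<close> covers it as well.\<close>

lemma right_angled_of_same_finite_quotients:
  fixes V :: "'a set" and V' :: "'b set"
  assumes lg: "labelled_graph V E m" and ra: "right_angled E m" and lg': "labelled_graph V' E' m'"
    and same: "same_finite_quotients (coxeter_group V' E' m') (coxeter_group V E m)"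
  shows "right_angled E' m'"
proof (rule ccontr)
  assume "\<not> right_angled E' m'"
  then obtain e where e: "e \<in> E'" "m' e \<noteq> 2" by (auto simp: right_angled_def)
  then have n: "3 \<le> m' e" "card e = 2" "e \<subseteq> V'" using lg' by (auto simp: labelled_graph_def)
  then obtain v w where vw: "e = {v, w}" by (auto simp: card_2_iff)
  have V': "v \<in> V'" "w \<in> V'" using n vw by auto
  have vwE: "{v, w} \<in> E'" "3 \<le> m' {v, w}" using e n vw by auto
  obtain Y :: "('b \<Rightarrow> int) set" and s where Y: "finite Y" and act: "coxeter_action V' E' m' Y s"
    and moved: "\<And>v w. {v, w} \<in> E' \<Longrightarrow> 3 \<le> m' {v, w} \<Longrightarrow> \<exists>y\<in>Y. foldr s [v, w, v, w] y \<noteq> y"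
    using reflection_action[OF lg'] by blast
  have finV: "finite V" using lg by (simp add: labelled_graph_def)
  obtain R1 :: "nat monoid" and c c' where R1: "group R1" "finite (carrier R1)"
    and c: "onto_rep V E m R1 c" and fac: "factors_reps V' E' m' (BijGroup Y) R1"
    by (rule common_factoring_quotient[OF group_BijGroup finite_BijGroup[OF Y] finV same])
  interpret R1: group R1 by fact
  have cr: "coxeter_rep V E m R1 c" using c by (simp add: onto_rep_def)
  define n where "n = m' e"
  obtain N :: nat and s2 where act2: "ra_action V E {..<N} s2" and tors: "\<And>t. set t \<subseteq> V \<Longrightarrow>
      \<forall>u\<in>V. even (count_list t u) \<Longrightarrow> \<forall>y<N. foldr s2 (concat (replicate n t)) y = y \<Longrightarrow> eval_word R1 c t = \<one>\<^bsub>R1\<^esub>"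
  proof -
    have "\<exists>(N :: nat) s. ra_action V E {..<N} s \<and>
      (\<forall>t. set t \<subseteq> V \<longrightarrow> (\<forall>w\<in>V. even (count_list t w)) \<longrightarrow>
       (\<forall>y<N. foldr s (concat (replicate n t)) y = y) \<longrightarrow> eval_word R1 c t = \<one>\<^bsub>R1\<^esub>)"
    proof (rule R1.torsion_detecting_action)
      show "finite (carrier R1)" "finite V" by fact+
      show "0 < n" using \<open>3 \<le> m' e\<close> by (simp add: n_def)
      show "c u \<in> carrier R1" if "u \<in> V" for u using coxeter_repD(1)[OF cr that] .
      show "c u \<otimes>\<^bsub>R1\<^esub> c u = \<one>\<^bsub>R1\<^esub>" if "u \<in> V" for u using R1.rep_involution[OF cr that] .
      show "c u \<otimes>\<^bsub>R1\<^esub> c u' = c u' \<otimes>\<^bsub>R1\<^esub> c u" if "u \<in> V" "u' \<in> V" "{u, u'} \<in> E" for u u'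
        by (rule rep_commute[OF ra R1(1) cr that])
    qed
    then show ?thesis using that by blast
  qed
  let ?B = "BijGroup {..<N}" and ?d = "\<lambda>u. restrict (s2 u) {..<N}"
  let ?T = "R1 \<times>\<times> ?B"
  note cact2 = ra_action_coxeter_action[OF ra act2]
  have T: "group ?T" "finite (carrier ?T)"
    using R1 group_BijGroup finite_BijGroup[of "{..<N}"] by (auto intro: DirProd_group)
  have ev_T: "eval_word ?T (\<lambda>u. (c u, ?d u)) zs = (eval_word R1 c zs, eval_word ?B ?d zs)" for zs
    by (induction zs) auto
  have rep: "coxeter_rep V E m ?T (\<lambda>u. (c u, ?d u))"
    using cr coxeter_action_rep(1)[OF cact2] unfolding coxeter_rep_def ev_T by simp
  obtain R :: "nat monoid" and j b where R: "group R" "finite (carrier R)" "onto_rep V E m R b"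
    and j: "j \<in> hom R ?T" "inj_on j (carrier R)" "\<And>u. u \<in> V \<Longrightarrow> j (b u) = (c u, ?d u)"
    by (rule onto_rep_image[OF T rep], rule that)
  interpret R: group R by fact
  have bR: "\<forall>u\<in>V. b u \<in> carrier R" and brep: "coxeter_rep V E m R b"
    using R(3) by (auto simp: onto_rep_def coxeter_rep_def)
  have j_ev: "j (eval_word R b zs) = (eval_word R1 c zs, eval_word ?B ?d zs)" if "set zs \<subseteq> V" for zs
  proof -
    have "j (eval_word R b zs) = eval_word ?T (\<lambda>u. j (b u)) zs"
      using eval_word_hom[OF R(1) T(1) j(1) bR that] by simp
    also have "\<dots> = eval_word ?T (\<lambda>u. (c u, ?d u)) zs" using that j(3) by (intro eval_word_cong) auto
    finally show ?thesis by (simp only: ev_T)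
  qed
  obtain b' where b': "onto_rep V' E' m' R b'"
    using same R unfolding same_finite_quotients_coxeter by blast
  have b'rep: "coxeter_rep V' E' m' R b'" using b' by (simp add: onto_rep_def)
  define x where "x = b' v"
  define y where "y = b' w"
  have xy: "x \<in> carrier R" "y \<in> carrier R"
    using coxeter_repD(1)[OF b'rep] V' by (auto simp: x_def y_def)
  have inv: "x \<otimes>\<^bsub>R\<^esub> x = \<one>\<^bsub>R\<^esub>" "y \<otimes>\<^bsub>R\<^esub> y = \<one>\<^bsub>R\<^esub>"
    using R.rep_involution[OF b'rep] V' by (auto simp: x_def y_def)
  obtain tx where tx: "set tx \<subseteq> V" "eval_word R b tx = x" by (rule onto_rep_word[OF R(3) xy(1)])
  obtain ty where ty: "set ty \<subseteq> V" "eval_word R b ty = y" by (rule onto_rep_word[OF R(3) xy(2)])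
  have rev: "eval_word R b (rev tx) = x" "eval_word R b (rev ty) = y"
  proof -
    have cl: "eval_word R b (rev tx) \<in> carrier R" "eval_word R b (rev ty) \<in> carrier R"
      using tx ty by (auto intro!: R.eval_word_closed[OF bR])
    have "x \<otimes>\<^bsub>R\<^esub> eval_word R b (rev tx) = x \<otimes>\<^bsub>R\<^esub> x" using R.eval_word_rev[OF brep tx(1)] tx inv by simp
    then show "eval_word R b (rev tx) = x" using cl xy R.l_cancel by blast
    have "y \<otimes>\<^bsub>R\<^esub> eval_word R b (rev ty) = y \<otimes>\<^bsub>R\<^esub> y" using R.eval_word_rev[OF brep ty(1)] ty inv by simp
    then show "eval_word R b (rev ty) = y" using cl xy R.l_cancel by blast
  qed
  \<comment> \<open>As \<open>x\<close> and \<open>y\<close> are involutions, the reversed words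
    have the same values; so \<open>t\<close> represents their commutator while containing each
    letter an even number of times.\<close>
  define t where "t = tx @ ty @ rev tx @ rev ty"
  define q where "q = (x \<otimes>\<^bsub>R\<^esub> y) \<otimes>\<^bsub>R\<^esub> (x \<otimes>\<^bsub>R\<^esub> y)"
  have tV: "set t \<subseteq> V" using tx ty by (auto simp: t_def)
  have ev_t: "eval_word R b t = q"
    using tx ty xy rev by (simp add: t_def q_def R.eval_word_append[OF bR] R.m_assoc)
  have even: "\<forall>u\<in>V. even (count_list t u)"
    by (auto simp: t_def)
  have tnV: "set (concat (replicate n t)) \<subseteq> V" by (rule order_trans[OF set_concat_replicate tV])
  have "(x \<otimes>\<^bsub>R\<^esub> y) [^]\<^bsub>R\<^esub> n = \<one>\<^bsub>R\<^esub>"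
  proof -
    have "concat (replicate (m' {v, w}) [v, w]) \<in> coxeter_relators V' E' m'"
      using V' vwE unfolding coxeter_relators_def by blast
    then have "eval_word R b' (concat (replicate n [v, w])) = \<one>\<^bsub>R\<^esub>"
      using coxeter_repD(2)[OF b'rep] by (simp add: n_def vw)
    moreover have "eval_word R b' (concat (replicate n [v, w])) = eval_word R b' [v, w] [^]\<^bsub>R\<^esub> n"
      by (rule R.eval_word_replicate[of V']) (use b'rep V' in \<open>auto simp: coxeter_rep_def\<close>)
    ultimately show ?thesis using xy by (simp add: x_def y_def)
  qed
  then have "q [^]\<^bsub>R\<^esub> n = \<one>\<^bsub>R\<^esub>"
    unfolding q_def using xy by (subst R.pow_mult_distrib) auto
  then have "eval_word R b (concat (replicate n t)) = \<one>\<^bsub>R\<^esub>"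
    using R.eval_word_replicate[OF bR tV, of n] ev_t by simp
  moreover have "j \<one>\<^bsub>R\<^esub> = (\<one>\<^bsub>R1\<^esub>, \<one>\<^bsub>?B\<^esub>)" using j_ev[of "[]"] by simp
  ultimately have "eval_word ?B ?d (concat (replicate n t)) = eval_word ?B ?d []"
    using j_ev[OF tnV] by simp
  moreover have "eval_word ?B ?d [] = restrict (foldr s2 []) {..<N}"
    by (rule coxeter_action_rep(2)[OF cact2]) simp
  ultimately have "restrict (foldr s2 (concat (replicate n t))) {..<N} = restrict (foldr s2 []) {..<N}"
    using coxeter_action_rep(2)[OF cact2 tnV] by (simp only:)
  then have "\<forall>y<N. foldr s2 (concat (replicate n t)) y = y"
    unfolding restrict_eq_restrict_iff by simp
  then have "eval_word R1 c t = \<one>\<^bsub>R1\<^esub>" by (rule tors[OF tV even])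
  then have fq: "fst (j q) = \<one>\<^bsub>R1\<^esub>" using j_ev[OF tV] ev_t by simp
  \<comment> \<open>The projection of \<open>R\<close> to \<open>R1\<close>; composed with
    \<open>b'\<close> it gives the surjection to which \<open>fac\<close> is applied.\<close>
  define k where "k r = fst (j r)" for r
  have k: "k \<in> hom R R1"
    using j(1) by (auto simp: k_def hom_def Pi_iff mult_DirProd' mem_Times_iff)
  have b'R: "\<forall>u\<in>V'. b' u \<in> carrier R" using b'rep by (simp add: coxeter_rep_def)
  have "k ` carrier R = carrier R1"
  proof
    show "carrier R1 \<subseteq> k ` carrier R"
    proof
      fix r assume "r \<in> carrier R1"
      then obtain zs where zs: "set zs \<subseteq> V" "eval_word R1 c zs = r" by (rule onto_rep_word[OF c])
      then have "k (eval_word R b zs) = r" by (simp add: k_def j_ev)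
      then show "r \<in> k ` carrier R" using R.eval_word_closed[OF bR zs(1)] by blast
    qed
  qed (use hom_in_carrier[OF k] in auto)
  moreover have "eval_word R1 (\<lambda>u. k (b' u)) ` {xs. set xs \<subseteq> V'} = k ` eval_word R b' ` {xs. set xs \<subseteq> V'}"
    unfolding image_image by (rule image_cong) (simp_all add: eval_word_hom[OF R(1) R1(1) k b'R])
  ultimately have onto: "onto_rep V' E' m' R1 (\<lambda>u. k (b' u))"
    using coxeter_rep_hom[OF R(1) R1(1) k b'rep] b' by (simp add: onto_rep_def)
  have word: "set [v, w, v, w] \<subseteq> V'" "set [] \<subseteq> V'" using V' by auto
  have "eval_word R1 (\<lambda>u. k (b' u)) [v, w, v, w] = k q"
    unfolding eval_word_hom[OF R(1) R1(1) k b'R word(1)]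
    using xy by (simp add: q_def x_def y_def R.m_assoc)
  then have "eval_word R1 (\<lambda>u. k (b' u)) [v, w, v, w] = eval_word R1 (\<lambda>u. k (b' u)) []"
    using fq by (simp add: k_def)
  then have "foldr s [v, w, v, w] z = foldr s [] z" if "z \<in> Y" for z
    by (rule action_relators_factor[OF fac onto act word _ that])
  then show False using moved[OF vwE] by auto
qed

section \<open>Rigidity among right-angled groups\<close>

text \<open>The image of a word in the abelianisation, as a set of vertices.\<close>

definition parity_set :: "'a set \<Rightarrow> 'a list \<Rightarrow> 'a set" where
  "parity_set V xs = {v \<in> V. odd (count_list xs v)}"

lemma parity_set_append: "parity_set V (xs @ ys) = sym_diff (parity_set V xs) (parity_set V ys)"
  by (auto simp: parity_set_def)

lemma parity_set_subset: "parity_set V xs \<subseteq> V"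
  by (auto simp: parity_set_def)

lemma count_list_distinct: "distinct xs \<Longrightarrow> count_list xs v = (if v \<in> set xs then 1 else 0)"
  by (induction xs) auto

lemma parity_set_distinct: "distinct xs \<Longrightarrow> set xs \<subseteq> V \<Longrightarrow> parity_set V xs = set xs"
  by (auto simp: parity_set_def count_list_distinct)

text \<open>Counting the letters satisfying \<open>\<beta>\<close> modulo 2 is a linear functional
  on the abelianisation, so it depends on the parity set only.\<close>

lemma odd_length_filter:
  assumes "finite V" "set xs \<subseteq> V"
  shows "odd (length (filter \<beta> xs)) \<longleftrightarrow> odd (card {v \<in> parity_set V xs. \<beta> v})"
proof -
  have "length (filter \<beta> xs) = (\<Sum>v\<in>{v \<in> V. \<beta> v}. count_list xs v)"
    using assms(2)
  proof (induction xs)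
    case (Cons x xs)
    have "(\<Sum>v\<in>{v \<in> V. \<beta> v}. count_list (x # xs) v) =
        (\<Sum>v\<in>{v \<in> V. \<beta> v}. count_list xs v) + (\<Sum>v\<in>{v \<in> V. \<beta> v}. if x = v then 1 else 0)"
      unfolding sum.distrib[symmetric] by (rule sum.cong) auto
    also have "(\<Sum>v\<in>{v \<in> V. \<beta> v}. if x = v then 1 else 0) = (if \<beta> x then 1 else 0 :: nat)"
      using assms(1) Cons.prems by simp
    finally show ?case using Cons by simp
  qed simp
  then have "odd (length (filter \<beta> xs)) \<longleftrightarrow> odd (card {v \<in> {v \<in> V. \<beta> v}. odd (count_list xs v)})"
    using assms(1) by (simp add: even_sum_iff)
  also have "{v \<in> {v \<in> V. \<beta> v}. odd (count_list xs v)} = {v \<in> parity_set V xs. \<beta> v}"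
    by (auto simp: parity_set_def)
  finally show ?thesis .
qed

section \<open>The dihedral test action\<close>

definition flip_fst :: "bool \<times> bool \<times> bool \<Rightarrow> bool \<times> bool \<times> bool" where
  "flip_fst = (\<lambda>(x, y, z). (\<not> x, y, z))"

text \<open>Triples are coordinates of the Heisenberg group over the field with two elements, which
  is dihedral of order 8. The entry \<open>z \<noteq> x\<close> adds \<open>x\<close> to
  \<open>z\<close>; the third coordinate records the commutator.\<close>

definition flip_snd :: "bool \<times> bool \<times> bool \<Rightarrow> bool \<times> bool \<times> bool" where
  "flip_snd = (\<lambda>(x, y, z). (x, \<not> y, z \<noteq> x))"

text \<open>The two involutions generate the dihedral group of order 8, in which a word containing each
  of them an odd number of times has order 4.\<close>
definition d4_action :: "'a \<Rightarrow> 'a \<Rightarrow> 'a \<Rightarrow> bool \<times> bool \<times> bool \<Rightarrow> bool \<times> bool \<times> bool" where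
  "d4_action a b u = (if u = a then flip_fst else if u = b then flip_snd else id)"

lemma d4_action_simps:
  "d4_action a b a = flip_fst" "a \<noteq> b \<Longrightarrow> d4_action a b b = flip_snd"
  "u \<noteq> a \<Longrightarrow> u \<noteq> b \<Longrightarrow> d4_action a b u = id"
  by (simp_all add: d4_action_def fun_eq_iff)

lemma ra_action_d4:
  assumes "a = b \<or> {a, b} \<notin> E"
  shows "ra_action V E UNIV (d4_action a b)"
  using assms by (auto simp: ra_action_def d4_action_def flip_fst_def flip_snd_def insert_commute)

text \<open>The correction \<open>\<delta>\<close> depends on the word only. When the word is
  applied twice it cancels, and the third coordinate changes by the product of the two
  parities.\<close>

lemma d4_action_fold:
  assumes "a \<noteq> b"
  shows "\<exists>\<delta>. \<forall>x y z. foldr (d4_action a b) xs (x, y, z) =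
    (x \<noteq> odd (count_list xs a), y \<noteq> odd (count_list xs b), z \<noteq> (\<delta> \<noteq> (x \<and> odd (count_list xs b))))"
proof (induction xs)
  case Nil
  show ?case by (rule exI[of _ False]) simp
next
  case (Cons u xs)
  then obtain \<delta> where IH: "\<And>x y z. foldr (d4_action a b) xs (x, y, z) =
    (x \<noteq> odd (count_list xs a), y \<noteq> odd (count_list xs b), z \<noteq> (\<delta> \<noteq> (x \<and> odd (count_list xs b))))"
    by blast
  consider "u = a" | "u = b" | "u \<noteq> a" "u \<noteq> b" by blast
  then show ?case
  proof cases
    case 2
    \<comment> \<open>The letter \<open>b\<close> adds the current first coordinate, which is
      \<open>x\<close> plus the parity of \<open>a\<close>; the second summand goes into
      \<open>\<delta>\<close>.\<close>
    then show ?thesis using assms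
      by (intro exI[of _ "\<delta> \<noteq> odd (count_list xs a)"]) (auto simp: IH d4_action_simps flip_snd_def)
  qed (use assms in \<open>auto simp: IH d4_action_simps flip_fst_def intro!: exI[of _ \<delta>]\<close>)
qed

lemma d4_action_same_fold:
  "foldr (d4_action a a) xs (x, y, z) = (x \<noteq> odd (count_list xs a), y, z)"
proof (induction xs)
  case (Cons u xs)
  then show ?case by (cases "u = a") (auto simp: d4_action_simps flip_fst_def)
qed simp

abbreviation "D4 \<equiv> BijGroup (UNIV :: (bool \<times> bool \<times> bool) set)"

text \<open>With \<open>b = a\<close> the test action only toggles the first coordinate and so
  detects the parity of \<open>a\<close>. Hence the abelianisation is visible in
  \<open>R\<close>.\<close>

lemma parity_set_of_eval_word:
  assumes "right_angled E m" and R: "factors_reps V E m D4 R" "onto_rep V E m R c"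
    and xs: "set xs \<subseteq> V" "set ys \<subseteq> V" "eval_word R c xs = eval_word R c ys"
  shows "parity_set V xs = parity_set V ys"
proof -
  have "odd (count_list xs a) = odd (count_list ys a)" for a
  proof -
    have "foldr (d4_action a a) xs (False, False, False) = foldr (d4_action a a) ys (False, False, False)"
      by (rule action_relators_factor[OF R ra_action_coxeter_action[OF assms(1) ra_action_d4] xs]) auto
    then show ?thesis by (simp add: d4_action_same_fold)
  qed
  then show ?thesis by (auto simp: parity_set_def)
qed

text \<open>Two nonadjacent letters of odd parity define a test action in which the square of the
  word acts as the central involution.\<close>

lemma clique_parity_set:
  assumes "right_angled E m" and R: "factors_reps V E m D4 R" "onto_rep V E m R c"
    and xs: "set xs \<subseteq> V" and sq: "eval_word R c (xs @ xs) = \<one>\<^bsub>R\<^esub>"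
  shows "clique V E (parity_set V xs)"
  unfolding clique_def
proof (intro conjI ballI impI)
  fix a b assume a: "a \<in> parity_set V xs" and b: "b \<in> parity_set V xs" and "a \<noteq> b"
  have odd: "odd (count_list xs a)" "odd (count_list xs b)" using a b by (auto simp: parity_set_def)
  show "{a, b} \<in> E"
  proof (rule ccontr)
    assume "{a, b} \<notin> E"
    then have "foldr (d4_action a b) (xs @ xs) (False, False, False) = foldr (d4_action a b) [] (False, False, False)"
      using xs sq
      by (intro action_relators_factor[OF R ra_action_coxeter_action[OF assms(1) ra_action_d4]]) auto
    moreover obtain \<delta> where "\<And>x y z. foldr (d4_action a b) xs (x, y, z) =
      (x \<noteq> odd (count_list xs a), y \<noteq> odd (count_list xs b), z \<noteq> (\<delta> \<noteq> (x \<and> odd (count_list xs b))))"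
      using d4_action_fold[OF \<open>a \<noteq> b\<close>, of xs] by blast
    ultimately show False using odd by simp
  qed
qed (rule parity_set_subset)

lemma (in group) eval_word_commuting_involutions:
  assumes "\<forall>v\<in>set xs. c v \<in> carrier G \<and> c v \<otimes> c v = \<one>"
    and "\<forall>v\<in>set xs. \<forall>w\<in>set xs. c v \<otimes> c w = c w \<otimes> c v"
  shows "eval_word G c xs \<otimes> eval_word G c xs = \<one>"
  using assms
proof (induction xs)
  case (Cons v xs)
  note inv = Cons.prems(1) and com0 = Cons.prems(2)
  have cl: "eval_word G c ys \<in> carrier G" if "set ys \<subseteq> set (v # xs)" for ys
    using Cons.prems(1) that by (intro eval_word_closed[of "set (v # xs)"]) auto
  have v: "c v \<in> carrier G" "c v \<otimes> c v = \<one>" using Cons.prems(1) by auto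
  have com: "c v \<otimes> eval_word G c ys = eval_word G c ys \<otimes> c v" if "set ys \<subseteq> set xs" for ys
    using that
  proof (induction ys)
    case (Cons w ys)
    then have "w \<in> set (v # xs)" by auto
    then have w: "c w \<in> carrier G" "c v \<otimes> c w = c w \<otimes> c v" using inv com0 by auto
    have y: "eval_word G c ys \<in> carrier G" using Cons.prems by (intro cl) auto
    have "c v \<otimes> eval_word G c (w # ys) = (c v \<otimes> c w) \<otimes> eval_word G c ys" using v(1) w(1) y by (simp add: m_assoc)
    also have "\<dots> = c w \<otimes> (c v \<otimes> eval_word G c ys)" unfolding w(2) using v(1) w(1) y by (rule_tac m_assoc)
    also have "c v \<otimes> eval_word G c ys = eval_word G c ys \<otimes> c v" using Cons.IH Cons.prems by simp
    also have "c w \<otimes> (eval_word G c ys \<otimes> c v) = eval_word G c (w # ys) \<otimes> c v" using v(1) w(1) y by (simp add: m_assoc)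
    finally show ?case .
  qed (use v in simp)
  have x: "eval_word G c xs \<in> carrier G" by (intro cl) auto
  have "eval_word G c (v # xs) \<otimes> eval_word G c (v # xs) = c v \<otimes> (eval_word G c xs \<otimes> c v) \<otimes> eval_word G c xs"
    using v x by (simp add: m_assoc)
  also have "\<dots> = (c v \<otimes> c v) \<otimes> (eval_word G c xs \<otimes> eval_word G c xs)"
    unfolding com[OF order_refl, symmetric] using v(1) x by (simp add: m_assoc)
  also have "\<dots> = \<one>" using v Cons by simp
  finally show ?case .
qed simp

text \<open>The converse of \<open>clique_parity_set\<close>: the generators of a clique commute, so
  a word listing each of them once has trivial square.\<close>

lemma clique_square_trivial:
  assumes "labelled_graph V E m" "right_angled E m" "group R" "coxeter_rep V E m R c" "clique V E S"
  obtains xs where "set xs \<subseteq> V" "parity_set V xs = S" "eval_word R c (xs @ xs) = \<one>\<^bsub>R\<^esub>"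
proof -
  interpret group R by fact
  have SV: "S \<subseteq> V" using assms(5) by (simp add: clique_def)
  moreover have "finite V" using assms(1) by (simp add: labelled_graph_def)
  ultimately have "finite S" by (rule finite_subset)
  then obtain xs where xs: "set xs = S" "distinct xs" using finite_distinct_list by blast
  have c: "\<forall>v\<in>V. c v \<in> carrier R" using assms(4) by (simp add: coxeter_rep_def)
  have "eval_word R c xs \<otimes>\<^bsub>R\<^esub> eval_word R c xs = \<one>\<^bsub>R\<^esub>"
  proof (rule eval_word_commuting_involutions)
    show "\<forall>v\<in>set xs. c v \<in> carrier R \<and> c v \<otimes>\<^bsub>R\<^esub> c v = \<one>\<^bsub>R\<^esub>"
      using c SV xs rep_involution[OF assms(4)] by auto
    show "\<forall>v\<in>set xs. \<forall>w\<in>set xs. c v \<otimes>\<^bsub>R\<^esub> c w = c w \<otimes>\<^bsub>R\<^esub> c v"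
    proof (intro ballI)
      fix v w assume vw: "v \<in> set xs" "w \<in> set xs"
      show "c v \<otimes>\<^bsub>R\<^esub> c w = c w \<otimes>\<^bsub>R\<^esub> c v"
      proof (cases "v = w")
        case False
        then have "{v, w} \<in> E" using assms(5) vw xs by (simp add: clique_def)
        then show ?thesis using vw xs SV by (intro rep_commute[OF assms(2-4)]) auto
      qed simp
    qed
  qed
  then have "eval_word R c (xs @ xs) = \<one>\<^bsub>R\<^esub>" using eval_word_append[OF c, of xs xs] xs SV by simp
  moreover have "parity_set V xs = S" using parity_set_distinct[OF xs(2)] xs SV by simp
  ultimately show ?thesis using that[of xs] xs SV by simp
qed

text \<open>Reading parities over \<open>V'\<close> is a homomorphism from \<open>R\<close> to an
  abelian group of exponent 2. On words over \<open>V\<close> such a homomorphism can only depend on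
  the parities of their letters.\<close>

lemma parity_set_transfer:
  fixes V :: "'a set" and V' :: "'b set"
  assumes "finite V" "group R" "onto_rep V E m R c" "onto_rep V' E' m' R c'"
    and par: "\<And>xs ys. set xs \<subseteq> V' \<Longrightarrow> set ys \<subseteq> V' \<Longrightarrow> eval_word R c' xs = eval_word R c' ys \<Longrightarrow> parity_set V' xs = parity_set V' ys"
    and xs: "set xs \<subseteq> V" "set xs' \<subseteq> V'" "eval_word R c xs = eval_word R c' xs'"
    and ys: "set ys \<subseteq> V" "set ys' \<subseteq> V'" "eval_word R c ys = eval_word R c' ys'"
    and eq: "parity_set V xs = parity_set V ys"
  shows "parity_set V' xs' = parity_set V' ys'"
proof -
  interpret group R by fact
  have cV: "\<forall>v\<in>V. c v \<in> carrier R" and cV': "\<forall>v\<in>V'. c' v \<in> carrier R"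
    using assms(3,4) by (auto simp: onto_rep_def coxeter_rep_def)
  define wd where "wd r = (SOME zs. set zs \<subseteq> V' \<and> eval_word R c' zs = r)" for r
  have wd: "set (wd r) \<subseteq> V' \<and> eval_word R c' (wd r) = r" if "r \<in> carrier R" for r
  proof -
    have "\<exists>zs. set zs \<subseteq> V' \<and> eval_word R c' zs = r" using onto_rep_word[OF assms(4) that] by blast
    then show ?thesis unfolding wd_def by (rule someI_ex)
  qed
  define par_set where "par_set r = parity_set V' (wd r)" for r
  have ps_ev: "par_set (eval_word R c' zs) = parity_set V' zs" if zs: "set zs \<subseteq> V'" for zs
    unfolding par_set_def using wd[OF eval_word_closed[OF cV' zs]] zs by (intro par) auto
  have ps_mult: "par_set (r \<otimes>\<^bsub>R\<^esub> r') = sym_diff (par_set r) (par_set r')" if r: "r \<in> carrier R" "r' \<in> carrier R" for r r'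
  proof -
    have "r \<otimes>\<^bsub>R\<^esub> r' = eval_word R c' (wd r @ wd r')" using wd r by (simp add: eval_word_append[OF cV'])
    then show ?thesis using ps_ev[of "wd r @ wd r'"] wd r by (simp add: parity_set_append par_set_def)
  qed
  have ps_1: "par_set \<one>\<^bsub>R\<^esub> = {}" using ps_ev[of "[]"] by (simp add: parity_set_def)
  have ps: "w \<in> par_set (eval_word R c zs) \<longleftrightarrow> odd (length (filter (\<lambda>v. w \<in> par_set (c v)) zs))"
    if "set zs \<subseteq> V" for zs w
    using that
  proof (induction zs)
    case (Cons v zs)
    then have "par_set (eval_word R c (v # zs)) = sym_diff (par_set (c v)) (par_set (eval_word R c zs))"
      using cV eval_word_closed[OF cV, of zs] by (simp add: ps_mult)
    then show ?case using Cons by auto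
  qed (simp add: ps_1)
  have "par_set (eval_word R c xs) = par_set (eval_word R c ys)"
    using ps[OF xs(1)] ps[OF ys(1)] odd_length_filter[OF assms(1) xs(1)] odd_length_filter[OF assms(1) ys(1)] eq
    by auto
  then show ?thesis using xs ys ps_ev by simp
qed

text \<open>Both abelianisations are quotients of \<open>R\<close>, with the same kernel by
  \<open>parity_set_transfer\<close>, which gives \<open>f\<close>. A set is a clique exactly when
  it lifts to an element of \<open>R\<close> with trivial square, a condition that mentions neither
  graph.\<close>

lemma clique_iso_of_common_quotient:
  fixes V :: "'a set" and V' :: "'b set"
  assumes lg: "labelled_graph V E m" "labelled_graph V' E' m'"
    and ra: "right_angled E m" "right_angled E' m'" and R: "group R"
    and c: "onto_rep V E m R c" "factors_reps V E m D4 R"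
    and c': "onto_rep V' E' m' R c'" "factors_reps V' E' m' D4 R"
  obtains f where "clique_iso V E V' E' f"
proof -
  interpret group R by fact
  have fin: "finite V" "finite V'" using lg by (auto simp: labelled_graph_def)
  have cV: "\<forall>v\<in>V. c v \<in> carrier R" and cV': "\<forall>v\<in>V'. c' v \<in> carrier R"
    and cr: "coxeter_rep V E m R c" and cr': "coxeter_rep V' E' m' R c'"
    using c(1) c'(1) by (auto simp: onto_rep_def coxeter_rep_def)
  note par = parity_set_of_eval_word[OF ra(1) c(2,1)] and par' = parity_set_of_eval_word[OF ra(2) c'(2,1)]
  have ex: "\<exists>xs'. set xs' \<subseteq> V' \<and> eval_word R c' xs' = eval_word R c xs" if "set xs \<subseteq> V" for xs
    by (rule onto_rep_word[OF c'(1) eval_word_closed[OF cV that]]) blast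
  have ex': "\<exists>xs. set xs \<subseteq> V \<and> eval_word R c xs = eval_word R c' xs'" if "set xs' \<subseteq> V'" for xs'
    by (rule onto_rep_word[OF c(1) eval_word_closed[OF cV' that]]) blast
  have "\<exists>xs xs'. set xs \<subseteq> V \<and> set xs' \<subseteq> V' \<and> eval_word R c xs = eval_word R c' xs' \<and> parity_set V xs = S"
    if S: "S \<subseteq> V" for S
  proof -
    obtain xs where xs: "set xs = S" "distinct xs" using finite_distinct_list finite_subset[OF S fin(1)] by blast
    then show ?thesis using ex[of xs] parity_set_distinct[OF xs(2), of V] S by metis
  qed
  then obtain w w' where w: "\<And>S. S \<subseteq> V \<Longrightarrow> set (w S) \<subseteq> V \<and> set (w' S) \<subseteq> V' \<and>
      eval_word R c (w S) = eval_word R c' (w' S) \<and> parity_set V (w S) = S" by metis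
  have "\<exists>xs xs'. set xs \<subseteq> V \<and> set xs' \<subseteq> V' \<and> eval_word R c xs = eval_word R c' xs' \<and> parity_set V' xs' = S"
    if S: "S \<subseteq> V'" for S
  proof -
    obtain xs' where xs': "set xs' = S" "distinct xs'" using finite_distinct_list finite_subset[OF S fin(2)] by blast
    then show ?thesis using ex'[of xs'] parity_set_distinct[OF xs'(2), of V'] S by metis
  qed
  then obtain u u' where u: "\<And>S. S \<subseteq> V' \<Longrightarrow> set (u S) \<subseteq> V \<and> set (u' S) \<subseteq> V' \<and>
      eval_word R c (u S) = eval_word R c' (u' S) \<and> parity_set V' (u' S) = S" by metis
  define f where "f S = parity_set V' (w' S)" for S
  define g where "g S = parity_set V (u S)" for S
  \<comment> \<open>Independence of the choices \<open>w\<close> and \<open>w'\<close>: any two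
    words with the same value in \<open>R\<close> compute \<open>f\<close>.\<close>
  have f: "f (parity_set V xs) = parity_set V' xs'"
    if "set xs \<subseteq> V" "set xs' \<subseteq> V'" "eval_word R c xs = eval_word R c' xs'" for xs xs'
    unfolding f_def
    by (rule parity_set_transfer[OF fin(1) R c(1) c'(1) par', where xs = "w (parity_set V xs)" and ys = xs])
      (use w[OF parity_set_subset, of xs] that in auto)
  have g: "g (parity_set V' xs') = parity_set V xs"
    if "set xs \<subseteq> V" "set xs' \<subseteq> V'" "eval_word R c xs = eval_word R c' xs'" for xs xs'
    unfolding g_def
    by (rule parity_set_transfer[OF fin(2) R c'(1) c(1) par, where xs = "u' (parity_set V' xs')" and ys = xs'])
      (use u[OF parity_set_subset, of xs'] that in auto)
  have gf: "g (f S) = S" if "S \<subseteq> V" for S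
    using g[of "w S" "w' S"] w[OF that] by (simp add: f_def)
  have fg: "f (g S) = S" if "S \<subseteq> V'" for S
    using f[of "u S" "u' S"] u[OF that] by (simp add: g_def)
  have "bij_betw f (Pow V) (Pow V')"
  proof (rule bij_betwI[of _ _ _ g])
    show "f \<in> Pow V \<rightarrow> Pow V'" by (simp add: f_def parity_set_subset)
    show "g \<in> Pow V' \<rightarrow> Pow V" by (simp add: g_def parity_set_subset)
  qed (simp_all add: gf fg)
  moreover have "f (sym_diff S T) = sym_diff (f S) (f T)" if ST: "S \<subseteq> V" "T \<subseteq> V" for S T
  proof -
    have "f (parity_set V (w S @ w T)) = parity_set V' (w' S @ w' T)"
      by (rule f) (use w[OF ST(1)] w[OF ST(2)] in \<open>simp_all add: eval_word_append[OF cV] eval_word_append[OF cV']\<close>)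
    then show ?thesis using w[OF ST(1)] w[OF ST(2)] by (simp add: parity_set_append f_def)
  qed
  moreover have "clique V E S = clique V' E' (f S)" if S: "S \<subseteq> V" for S
  proof
    assume "clique V E S"
    then obtain xs where xs: "set xs \<subseteq> V" "parity_set V xs = S" "eval_word R c (xs @ xs) = \<one>\<^bsub>R\<^esub>"
      by (rule clique_square_trivial[OF lg(1) ra(1) R cr])
    obtain xs' where xs': "set xs' \<subseteq> V'" "eval_word R c' xs' = eval_word R c xs" using ex[OF xs(1)] by blast
    have "eval_word R c' (xs' @ xs') = \<one>\<^bsub>R\<^esub>"
      using xs xs' by (simp add: eval_word_append[OF cV] eval_word_append[OF cV'])
    then have "clique V' E' (parity_set V' xs')"
      by (rule clique_parity_set[OF ra(2) c'(2,1) xs'(1)])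
    then show "clique V' E' (f S)" using f[OF xs(1) xs'(1)] xs xs' by simp
  next
    assume "clique V' E' (f S)"
    then obtain xs' where xs': "set xs' \<subseteq> V'" "parity_set V' xs' = f S" "eval_word R c' (xs' @ xs') = \<one>\<^bsub>R\<^esub>"
      by (rule clique_square_trivial[OF lg(2) ra(2) R cr'])
    obtain xs where xs: "set xs \<subseteq> V" "eval_word R c xs = eval_word R c' xs'" using ex'[OF xs'(1)] by blast
    have "eval_word R c (xs @ xs) = \<one>\<^bsub>R\<^esub>"
      using xs xs' by (simp add: eval_word_append[OF cV] eval_word_append[OF cV'])
    then have "clique V E (parity_set V xs)"
      by (rule clique_parity_set[OF ra(1) c(2,1) xs(1)])
    then show "clique V E S" using g[OF xs(1) xs'(1)] xs xs' gf[OF S] by simp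
  qed
  ultimately have "clique_iso V E V' E' f" by (simp add: clique_iso_def)
  then show ?thesis by (rule that)
qed

section \<open>From a graph isomorphism to a group isomorphism\<close>

lemma coxeter_eq_map:
  assumes ra: "right_angled E m" "right_angled E' m'"
    and \<phi>: "\<And>v. v \<in> V \<Longrightarrow> \<phi> v \<in> V'"
    and edge: "\<And>v w. v \<in> V \<Longrightarrow> w \<in> V \<Longrightarrow> {v, w} \<in> E \<Longrightarrow> {\<phi> v, \<phi> w} \<in> E'"
  shows "coxeter_eq V E m xs ys \<Longrightarrow> coxeter_eq V' E' m' (map \<phi> xs) (map \<phi> ys)"
proof (induction rule: coxeter_eq.induct)
  case (refl xs)
  then show ?case using \<phi> by (intro coxeter_eq.refl) auto
next
  case (sym xs ys)
  then show ?case by (blast intro: coxeter_eq.sym)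
next
  case (trans xs ys zs)
  show ?case by (rule coxeter_eq.trans[OF trans.IH])
next
  case (del xs ys r)
  from del(3) have "map \<phi> r \<in> coxeter_relators V' E' m'"
    unfolding coxeter_relators_def
  proof (elim UnE CollectE exE conjE)
    fix v assume "r = [v, v]" "v \<in> V"
    then show "map \<phi> r \<in> {[v, v] |v. v \<in> V'} \<union>
        {concat (replicate (m' {v, w}) [v, w]) |v w. v \<in> V' \<and> w \<in> V' \<and> {v, w} \<in> E'}"
      using \<phi> by simp
  next
    fix v w assume r: "r = concat (replicate (m {v, w}) [v, w])" and vw: "v \<in> V" "w \<in> V" "{v, w} \<in> E"
    \<comment> \<open>Both graphs are right-angled, so corresponding edges carry the same label and
      relators go to relators.\<close>
    have "m {v, w} = 2" "m' {\<phi> v, \<phi> w} = 2"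
      using ra vw edge by (auto simp: right_angled_def)
    then have "map \<phi> r = concat (replicate (m' {\<phi> v, \<phi> w}) [\<phi> v, \<phi> w])"
      by (simp add: r numeral_2_eq_2)
    then show "map \<phi> r \<in> {[v, v] |v. v \<in> V'} \<union>
        {concat (replicate (m' {v, w}) [v, w]) |v w. v \<in> V' \<and> w \<in> V' \<and> {v, w} \<in> E'}"
      using \<phi> vw edge by blast
  qed
  then show ?case unfolding map_append using del \<phi> by (intro coxeter_eq.del) auto
qed

lemma coxeter_group_iso:
  assumes lg: "labelled_graph V E m" "labelled_graph V' E' m'"
    and ra: "right_angled E m" "right_angled E' m'"
    and \<phi>: "bij_betw \<phi> V V'"
    and edge: "\<And>v w. v \<in> V \<Longrightarrow> w \<in> V \<Longrightarrow> v \<noteq> w \<Longrightarrow> {v, w} \<in> E \<longleftrightarrow> {\<phi> v, \<phi> w} \<in> E'"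
  shows "coxeter_group V E m \<cong> coxeter_group V' E' m'"
proof -
  let ?cl = "coxeter_class V E m" and ?cl' = "coxeter_class V' E' m'"
  define \<psi> where "\<psi> = inv_into V \<phi>"
  have \<phi>V: "\<phi> v \<in> V'" if "v \<in> V" for v using bij_betwE[OF \<phi>] that by blast
  have \<psi>V: "\<psi> v \<in> V" if "v \<in> V'" for v
    using bij_betwE[OF bij_betw_inv_into[OF \<phi>]] that by (simp add: \<psi>_def)
  have \<psi>\<phi>: "\<psi> (\<phi> v) = v" if "v \<in> V" for v using bij_betw_inv_into_left[OF \<phi> that] by (simp add: \<psi>_def)
  have \<phi>\<psi>: "\<phi> (\<psi> v) = v" if "v \<in> V'" for v using bij_betw_inv_into_right[OF \<phi> that] by (simp add: \<psi>_def)
  have to: "coxeter_eq V' E' m' (map \<phi> xs) (map \<phi> ys)" if "coxeter_eq V E m xs ys" for xs ys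
    by (rule coxeter_eq_map[OF ra \<phi>V _ that])
      (use edge distinct_vertices[OF lg(1)] in blast)+
  have bwd: "coxeter_eq V E m (map \<psi> xs) (map \<psi> ys)" if "coxeter_eq V' E' m' xs ys" for xs ys
  proof (rule coxeter_eq_map[OF ra(2,1) \<psi>V _ that])
    fix v w assume vw: "v \<in> V'" "w \<in> V'" "{v, w} \<in> E'"
    have "\<psi> v \<noteq> \<psi> w" using distinct_vertices[OF lg(2) vw(3)] \<phi>\<psi> vw by metis
    then show "{\<psi> v, \<psi> w} \<in> E" using edge[OF \<psi>V \<psi>V] vw \<phi>\<psi> by simp
  qed
  define h where "h A = ?cl' (map \<phi> (SOME x. x \<in> A))" for A
  have h: "h (?cl xs) = ?cl' (map \<phi> xs)" if "set xs \<subseteq> V" for xs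
    unfolding h_def by (rule coxeter_class_eqI[symmetric], rule to, rule coxeter_class_some[OF that])
  have map_V: "set (map \<phi> xs) \<subseteq> V'" if "set xs \<subseteq> V" for xs using that \<phi>V by auto
  have map_V': "set (map \<psi> xs) \<subseteq> V" if "set xs \<subseteq> V'" for xs using that \<psi>V by auto
  have id: "map \<psi> (map \<phi> xs) = xs" if "set xs \<subseteq> V" for xs
    using that \<psi>\<phi> by (induction xs) auto
  have id': "map \<phi> (map \<psi> xs) = xs" if "set xs \<subseteq> V'" for xs
    using that \<phi>\<psi> by (induction xs) auto
  have "h \<in> hom (coxeter_group V E m) (coxeter_group V' E' m')"
  proof (rule homI)
    fix A assume "A \<in> carrier (coxeter_group V E m)"
    then obtain xs where "set xs \<subseteq> V" "A = ?cl xs" by (auto simp: carrier_coxeter_group)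
    then show "h A \<in> carrier (coxeter_group V' E' m')"
      using map_V[of xs] h[of xs] unfolding carrier_coxeter_group by blast
    fix B assume "B \<in> carrier (coxeter_group V E m)"
    then obtain ys where "set ys \<subseteq> V" "B = ?cl ys" by (auto simp: carrier_coxeter_group)
    then show "h (A \<otimes>\<^bsub>coxeter_group V E m\<^esub> B) = h A \<otimes>\<^bsub>coxeter_group V' E' m'\<^esub> h B"
      using \<open>set xs \<subseteq> V\<close> \<open>A = ?cl xs\<close> map_V[of xs] map_V[of ys]
      by (simp add: mult_coxeter_group h del: set_map)
  qed
  moreover have "bij_betw h (carrier (coxeter_group V E m)) (carrier (coxeter_group V' E' m'))"
    unfolding bij_betw_def
  proof
    show "inj_on h (carrier (coxeter_group V E m))"
    proof (rule inj_onI)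
      fix A B assume "A \<in> carrier (coxeter_group V E m)" "B \<in> carrier (coxeter_group V E m)" and eq: "h A = h B"
      then obtain xs ys where xs: "set xs \<subseteq> V" "A = ?cl xs" and ys: "set ys \<subseteq> V" "B = ?cl ys"
        unfolding carrier_coxeter_group by blast
      have "coxeter_eq V' E' m' (map \<phi> xs) (map \<phi> ys)"
        using eq xs ys h coxeter_class_eq_iff[OF map_V[OF xs(1)] map_V[OF ys(1)]] by simp
      from bwd[OF this] show "A = B" using xs ys id coxeter_class_eqI by metis
    qed
    show "h ` carrier (coxeter_group V E m) = carrier (coxeter_group V' E' m')"
    proof
      show "h ` carrier (coxeter_group V E m) \<subseteq> carrier (coxeter_group V' E' m')"
        using hom_in_carrier[OF \<open>h \<in> hom _ _\<close>] by blast
      show "carrier (coxeter_group V' E' m') \<subseteq> h ` carrier (coxeter_group V E m)"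
      proof
        fix B assume "B \<in> carrier (coxeter_group V' E' m')"
        then obtain ys where ys: "set ys \<subseteq> V'" "B = ?cl' ys" unfolding carrier_coxeter_group by blast
        then have "B = h (?cl (map \<psi> ys))" using h[OF map_V'[OF ys(1)]] id'[OF ys(1)] by metis
        then show "B \<in> h ` carrier (coxeter_group V E m)"
          using map_V'[OF ys(1)] unfolding carrier_coxeter_group by blast
      qed
    qed
  qed
  ultimately show ?thesis unfolding is_iso_def iso_def by blast
qed

theorem theorem3p8:
  fixes V :: "'a set" and E :: "'a set set" and m :: "'a set \<Rightarrow> nat"
    and V' :: "'b set" and E' :: "'b set set" and m' :: "'b set \<Rightarrow> nat"
  assumes "labelled_graph V E m" and "right_angled E m"
    and "labelled_graph V' E' m'"
    and "same_finite_quotients (coxeter_group V' E' m') (coxeter_group V E m)"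
  shows "coxeter_group V' E' m' \<cong> coxeter_group V E m"
proof -
  have ra': "right_angled E' m'" by (rule right_angled_of_same_finite_quotients[OF assms])
  have fin: "finite V" "finite V'" using assms(1,3) by (auto simp: labelled_graph_def)
  have D4: "group D4" "finite (carrier D4)" by (rule group_BijGroup, rule finite_BijGroup, simp)
  obtain R :: "nat monoid" and c c' where R: "group R" "onto_rep V E m R c" "onto_rep V' E' m' R c'"
    "factors_reps V E m D4 R" "factors_reps V' E' m' D4 R"
    by (rule common_factoring_quotient[OF D4 fin(1) assms(4)])
  \<comment> \<open>The two graphs are exchanged so that the isomorphism comes out in the direction
    of the claim.\<close>
  obtain f where f: "clique_iso V' E' V E f"
    by (rule clique_iso_of_common_quotient[OF assms(3,1) ra' assms(2) R(1,3,5,2,4)])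
  obtain \<phi> where "bij_betw \<phi> V' V"
    "\<And>x y. x \<in> V' \<Longrightarrow> y \<in> V' \<Longrightarrow> x \<noteq> y \<Longrightarrow> {x, y} \<in> E' \<longleftrightarrow> {\<phi> x, \<phi> y} \<in> E"
    by (rule graph_iso_of_clique_iso[OF fin(2,1) f], rule that)
  then show ?thesis by (rule coxeter_group_iso[OF assms(3,1) ra' assms(2)])
qed

end
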